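(* Let $\mathbb{K}$ be Pol's compactum. Then $\dim_G(\mathbb{K})=\omega+1$.
   Context: Pol's compactum: a compact metrizable space $\mathbb{K}=M\cup L$, where $M$ is a completely metrizable, separable, totally disconnected, hereditarily strongly infinite dimensional space which is dense in $\mathbb{K}$, and the remainder $L=\mathbb{K}\setminus M$ is a union $L=\bigcup_{k=1}^{\infty}L_k$ of compact finite dimensional sets with $L_k\subset L_m$ and $\dim(L_k)<\dim(L_m)$ for $k<m$. A space is strongly infinite dimensional if it is not weakly infinite dimensional, where $X$ is weakly infinite dimensional if for each sequence $(\mathcal{U}_k)_{k\in\mathbb{N}}$ of two-element open covers of $X$ there are pairwise disjoint families $\mathcal{V}_k$ of sets refining $\mathcal{U}_k$ such that $\bigcup_k\mathcal{V}_k$ is an open cover of $X$. "Hereditarily strongly infinite dimensional" means that $M$ is strongly infinite dimensional and each subspace of $M$ is either at most zero-dimensional or strongly infinite dimensional. Game dimension: for an ordinal $\alpha$, the game ${\sf G}_c^{\alpha}(\mathcal{O},\mathcal{O})$ on a separable metric space $X$ has one inning per $\gamma<\alpha$: in inning $\gamma$ player ONE chooses an open cover $A_\gamma$ of $X$ and TWO responds with a pairwise disjoint family $B_\gamma$ of sets refining $A_\gamma$ (each member of $B_\gamma$ is contained in a member of $A_\gamma$). TWO wins the play if $\bigcup_{\gamma<\alpha}B_\gamma$ is an open cover of $X$; otherwise ONE wins. ${\sf tp}_{{\sf S}_c(\mathcal{O},\mathcal{O})}(X)$ is the least ordinal $\alpha$ such that TWO has a winning strategy in this game on $X$, and $\dim_G(X)$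 is defined by $1+\dim_G(X)={\sf tp}_{{\sf S}_c(\mathcal{O},\mathcal{O})}(X)$. *)

theory Defs
  imports "HOL-Analysis.Analysis"
begin

definition open_cover :: "'a topology \<Rightarrow> 'a set set \<Rightarrow> bool" where
  "open_cover X \<U> \<longleftrightarrow> (\<forall>U\<in>\<U>. openin X U) \<and> \<Union>\<U> = topspace X"

definition refining :: "'a set set \<Rightarrow> 'a set set \<Rightarrow> bool" where
  "refining \<V> \<U> \<longleftrightarrow> (\<forall>V\<in>\<V>. \<exists>U\<in>\<U>. V \<subseteq> U)"

text \<open>
  Lebesgue covering dimension \<open>dim X \<le> n\<close>, in the finite-cover form, with values in
  \<open>{-1, 0, 1, \<dots>}\<close> (only the empty space has dimension \<open>-1\<close>).  This is not the small
  inductive dimension provided by the library.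
\<close>
definition covering_dim_le :: "'a topology \<Rightarrow> int \<Rightarrow> bool" where
  "covering_dim_le X n \<longleftrightarrow>
     -1 \<le> n \<and>
     (\<forall>\<U>. finite \<U> \<and> open_cover X \<U> \<longrightarrow>
        (\<exists>\<V>. finite \<V> \<and> open_cover X \<V> \<and> refining \<V> \<U> \<and>
             (\<forall>x\<in>topspace X. int (card {V \<in> \<V>. x \<in> V}) \<le> n + 1)))"

definition has_covering_dim :: "'a topology \<Rightarrow> int \<Rightarrow> bool" where
  "has_covering_dim X n \<longleftrightarrow> covering_dim_le X n \<and> \<not> covering_dim_le X (n - 1)"

text \<open>The sets in the families \<open>\<V> k\<close> are only required to be disjoint within each family.\<close>
definition weakly_infinite_dimensional :: "'a topology \<Rightarrow> bool" where
  "weakly_infinite_dimensional X \<longleftrightarrow>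
     (\<forall>\<U> :: nat \<Rightarrow> 'a set set. (\<forall>k. open_cover X (\<U> k) \<and> card (\<U> k) = 2) \<longrightarrow>
        (\<exists>\<V> :: nat \<Rightarrow> 'a set set.
           (\<forall>k. disjoint (\<V> k) \<and> refining (\<V> k) (\<U> k)) \<and> open_cover X (\<Union>k. \<V> k)))"

definition strongly_infinite_dimensional :: "'a topology \<Rightarrow> bool" where
  "strongly_infinite_dimensional X \<longleftrightarrow> \<not> weakly_infinite_dimensional X"

definition hereditarily_strongly_infinite_dimensional :: "'a topology \<Rightarrow> bool" where
  "hereditarily_strongly_infinite_dimensional X \<longleftrightarrow>
     strongly_infinite_dimensional X \<and>
     (\<forall>S \<subseteq> topspace X. covering_dim_le (subtopology X S) 0 \<or>
                       strongly_infinite_dimensional (subtopology X S))"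

definition totally_disconnected_space :: "'a topology \<Rightarrow> bool" where
  "totally_disconnected_space X \<longleftrightarrow> (\<forall>S. connectedin X S \<longrightarrow> (\<exists>a. S \<subseteq> {a}))"

text \<open>The compact sets \<open>L\<^sub>1, L\<^sub>2, \<dots>\<close> are indexed from \<open>0\<close>.\<close>
definition Pol_compactum :: "'a topology \<Rightarrow> 'a set \<Rightarrow> (nat \<Rightarrow> 'a set) \<Rightarrow> bool" where
  "Pol_compactum K M L \<longleftrightarrow>
     compact_space K \<and> metrizable_space K \<and>
     M \<subseteq> topspace K \<and>
     completely_metrizable_space (subtopology K M) \<and>
     separable_space (subtopology K M) \<and>
     totally_disconnected_space (subtopology K M) \<and>
     hereditarily_strongly_infinite_dimensional (subtopology K M) \<and>
     K closure_of M = topspace K \<and>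
     topspace K - M = (\<Union>k. L k) \<and>
     (\<forall>k. compactin K (L k)) \<and>
     (\<forall>k m. k < m \<longrightarrow> L k \<subseteq> L m) \<and>
     (\<exists>d :: nat \<Rightarrow> int. strict_mono d \<and> (\<forall>k. has_covering_dim (subtopology K (L k)) (d k)))"

text \<open>
  Ordinals are represented by well-orders \<open>r\<close> (the ordinals below \<open>r\<close> being the elements of
  \<open>Field r\<close>), up to order isomorphism.  Thus \<open>\<omega>\<close> is \<^const>\<open>natLeq\<close>, and \<open>1\<close> is \<open>natLeq_on 1\<close>.
\<close>
definition ord_sum :: "'a rel \<Rightarrow> 'b rel \<Rightarrow> ('a + 'b) rel" where
  "ord_sum r s =
     {(Inl a, Inl b) |a b. (a, b) \<in> r} \<union>
     {(Inr a, Inr b) |a b. (a, b) \<in> s} \<union>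
     {(Inl a, Inr b) |a b. a \<in> Field r \<and> b \<in> Field s}"

text \<open>
  A strategy of TWO determines the move in inning \<open>\<gamma>\<close> from the moves of ONE in the innings up to
  and including \<open>\<gamma>\<close>; TWO's own earlier moves are determined by these.  A winning strategy must
  yield legal moves against every sequence of legal moves of ONE.
\<close>
definition TWO_winning_strategy ::
  "'o rel \<Rightarrow> 'a topology \<Rightarrow> ('o \<Rightarrow> ('o \<Rightarrow> 'a set set) \<Rightarrow> 'a set set) \<Rightarrow> bool" where
  "TWO_winning_strategy \<alpha> X \<sigma> \<longleftrightarrow>
     (\<forall>A. (\<forall>\<gamma>\<in>Field \<alpha>. open_cover X (A \<gamma>)) \<longrightarrow>
        (let B = (\<lambda>\<gamma>. \<sigma> \<gamma> (restrict A (under \<alpha> \<gamma>))) in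
           (\<forall>\<gamma>\<in>Field \<alpha>. disjoint (B \<gamma>) \<and> refining (B \<gamma>) (A \<gamma>)) \<and>
           open_cover X (\<Union>\<gamma>\<in>Field \<alpha>. B \<gamma>)))"

definition TWO_has_winning_strategy :: "'o rel \<Rightarrow> 'a topology \<Rightarrow> bool" where
  "TWO_has_winning_strategy \<alpha> X \<longleftrightarrow> (\<exists>\<sigma>. TWO_winning_strategy \<alpha> X \<sigma>)"

text \<open>
  \<open>\<alpha>\<close> is the least ordinal for which TWO has a winning strategy.  Letting \<open>\<beta>\<close> range over relations
  on the same type as \<open>\<alpha>\<close> loses nothing: every ordinal below \<open>\<alpha>\<close> is represented by an initial
  segment of \<open>\<alpha>\<close>.
\<close>
definition is_game_type :: "'a topology \<Rightarrow> 'o rel \<Rightarrow> bool" where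
  "is_game_type X \<alpha> \<longleftrightarrow>
     Well_order \<alpha> \<and> TWO_has_winning_strategy \<alpha> X \<and>
     (\<forall>\<beta> :: 'o rel. (\<beta>, \<alpha>) \<in> ordLess \<longrightarrow> \<not> TWO_has_winning_strategy \<beta> X)"

text \<open>
  \<open>dim\<^sub>G X = \<delta>\<close>, i.e. \<open>1 + \<delta>\<close> is the game type of \<open>X\<close>.  This determines \<open>\<delta>\<close> up to order
  isomorphism, since ordinal addition is left cancellative.
\<close>
definition has_game_dim :: "'a topology \<Rightarrow> 'o rel \<Rightarrow> bool" where
  "has_game_dim X \<delta> \<longleftrightarrow> Well_order \<delta> \<and> is_game_type X (ord_sum (natLeq_on 1) \<delta>)"

end

theory Submission
  imports Defs
begin

text \<open>
  Call a set zero-dimensional if every open family covering it has a pairwise disjoint open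
  refinement that still covers it.  Each \<open>L\<^sub>k\<close>, being compact and finite dimensional, is a countable
  union of zero-dimensional sets; so TWO, answering in inning \<open>n\<close> with a refinement that covers the
  \<open>n\<close>-th of these sets, has covered \<open>L\<close> after \<open>\<omega>\<close> innings.  What is left is a compact subset of the
  totally disconnected \<open>M\<close>, hence zero-dimensional, and one more inning suffices.

  Conversely, a winning strategy in at most \<open>\<omega>\<close> innings makes \<open>K\<close>, and hence \<open>M\<close>, a countable union of
  zero-dimensional sets.  Then \<open>M\<close> is weakly infinite dimensional, a contradiction.
\<close>

subsection \<open>Zero-dimensional and countable-dimensional subsets\<close>

text \<open>Zero-dimensionality of a subset is phrased with open sets of the whole space, because
  TWO's families must consist of such sets and be disjoint everywhere, not merely on the subset.
  Compactness of \<open>K\<close> is used twice for the upper bound: it gives Lebesgue numbers for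
  the compact remainders that appear when dimension is lowered, and it makes the part missed after
  \<omega> innings compact, where total disconnectedness does yield zero-dimensionality; for
  \<open>M\<close> itself it does not. The lower bound rests on finite histories: in a game of at
  most \<omega> innings each inning has finitely many predecessors, so if ONE is confined to a
  countable supply of covers, only countably many histories occur.\<close>

definition disjoint_open_refinement :: "'a topology \<Rightarrow> 'a set set \<Rightarrow> 'a set set \<Rightarrow> bool" where
  "disjoint_open_refinement X \<U> \<V> \<longleftrightarrow> disjoint \<V> \<and> refining \<V> \<U> \<and> (\<forall>V\<in>\<V>. openin X V)"

\<comment> \<open>Without \<open>C \<subseteq> topspace X\<close>, sets with no open cover at all would qualify.\<close>
definition zero_dim_in :: "'a topology \<Rightarrow> 'a set \<Rightarrow> bool" where
  "zero_dim_in X C \<longleftrightarrow>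
     C \<subseteq> topspace X \<and>
     (\<forall>\<U>. (\<forall>U\<in>\<U>. openin X U) \<and> C \<subseteq> \<Union>\<U> \<longrightarrow> (\<exists>\<V>. disjoint_open_refinement X \<U> \<V> \<and> C \<subseteq> \<Union>\<V>))"

text \<open>The members of \<open>\<Z>\<close> may reach outside \<open>C\<close>, which makes
  passing to subsets free. They are cut down only where the topology changes to that of a
  subspace.\<close>

definition countable_dim_in :: "'a topology \<Rightarrow> 'a set \<Rightarrow> bool" where
  "countable_dim_in X C \<longleftrightarrow> (\<exists>\<Z>. countable \<Z> \<and> (\<forall>Z\<in>\<Z>. zero_dim_in X Z) \<and> C \<subseteq> \<Union>\<Z>)"

\<comment> \<open>By Ostrand's theorem, \<open>colour_cover X (n + 1) C\<close> expresses \<open>dim C \<le> n\<close>.\<close>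
definition colour_cover :: "'a topology \<Rightarrow> nat \<Rightarrow> 'a set \<Rightarrow> bool" where
  "colour_cover X m C \<longleftrightarrow>
     (\<forall>\<U>. (\<forall>U\<in>\<U>. openin X U) \<and> C \<subseteq> \<Union>\<U> \<longrightarrow>
        (\<exists>\<V> :: nat \<Rightarrow> 'a set set. (\<forall>j<m. disjoint_open_refinement X \<U> (\<V> j)) \<and> C \<subseteq> (\<Union>j<m. \<Union>(\<V> j))))"

text \<open>For singletons \<open>R\<close> this is the usual notion of a development; for compact
  \<open>R\<close> it is a Lebesgue number condition. The metric is thereby replaced by countably
  many covers.\<close>

definition development :: "'a topology \<Rightarrow> (nat \<Rightarrow> 'a set set) \<Rightarrow> bool" where
  "development X E \<longleftrightarrow>
     (\<forall>n. open_cover X (E n)) \<and>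
     (\<forall>R \<U>. compactin X R \<and> (\<forall>U\<in>\<U>. openin X U) \<and> R \<subseteq> \<Union>\<U> \<longrightarrow>
        (\<exists>n. \<forall>V\<in>E n. V \<inter> R \<noteq> {} \<longrightarrow> (\<exists>U\<in>\<U>. V \<subseteq> U)))"


lemma zero_dim_in_empty: "zero_dim_in X {}"
  unfolding zero_dim_in_def disjoint_open_refinement_def refining_def
  by (intro conjI allI impI exI[of _ "{}"]) auto

lemma countable_dim_in_mono: "countable_dim_in X C \<Longrightarrow> B \<subseteq> C \<Longrightarrow> countable_dim_in X B"
  unfolding countable_dim_in_def by (meson order_trans)

lemma zero_dim_imp_countable_dim: "zero_dim_in X C \<Longrightarrow> countable_dim_in X C"
  unfolding countable_dim_in_def by (intro exI[of _ "{C}"]) auto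

lemma countable_dim_in_Union:
  assumes "countable \<A>" "\<And>A. A \<in> \<A> \<Longrightarrow> countable_dim_in X A"
  shows "countable_dim_in X (\<Union>\<A>)"
proof -
  obtain \<Z> where \<Z>: "\<And>A. A \<in> \<A> \<Longrightarrow> countable (\<Z> A) \<and> (\<forall>Z\<in>\<Z> A. zero_dim_in X Z) \<and> A \<subseteq> \<Union>(\<Z> A)"
    using assms(2) unfolding countable_dim_in_def by metis
  have "countable (\<Union>A\<in>\<A>. \<Z> A)" using assms(1) \<Z> by blast
  moreover have "\<forall>Z\<in>(\<Union>A\<in>\<A>. \<Z> A). zero_dim_in X Z" using \<Z> by blast
  moreover have "\<Union>\<A> \<subseteq> \<Union>(\<Union>A\<in>\<A>. \<Z> A)"
  proof
    fix x assume "x \<in> \<Union>\<A>"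
    then obtain A where "A \<in> \<A>" "x \<in> A" by blast
    with \<Z>[of A] show "x \<in> \<Union>(\<Union>A\<in>\<A>. \<Z> A)" by blast
  qed
  ultimately show ?thesis
    unfolding countable_dim_in_def by blast
qed

section \<open>Sequences of arbitrarily fine covers\<close>

lemma metrizable_imp_development:
  assumes "metrizable_space X"
  obtains E where "development X E"
proof -
  obtain S d where "Metric_space S d" and X: "X = Metric_space.mtopology S d"
    using assms unfolding metrizable_space_def by blast
  then interpret Metric_space S d by simp
  define E where "E = (\<lambda>n. (\<lambda>x. mball x (inverse (Suc n))) ` S)"
  have "open_cover X (E n)" for n
    unfolding open_cover_def X E_def by auto
  moreover have "\<exists>n. \<forall>V\<in>E n. V \<inter> R \<noteq> {} \<longrightarrow> (\<exists>U\<in>\<U>. V \<subseteq> U)"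
    if R: "compactin X R" "\<forall>U\<in>\<U>. openin X U" "R \<subseteq> \<Union>\<U>" for R \<U>
  proof -
    obtain \<epsilon> where \<epsilon>: "\<epsilon> > 0" "\<forall>x\<in>R. \<exists>U\<in>\<U>. mball x \<epsilon> \<subseteq> U"
      using lebesgue_number[of R \<U>] R unfolding X by blast
    \<comment> \<open>Half of \<open>\<epsilon>\<close>: a ball meeting \<open>R\<close> in
      \<open>y\<close> need not be centred in \<open>R\<close>, and reaching its points from
      \<open>y\<close> through the centre costs two radii.\<close>
    obtain n where n: "inverse (Suc n) < \<epsilon> / 2"
      using reals_Archimedean[of "\<epsilon>/2"] \<epsilon> by auto
    have "\<exists>U\<in>\<U>. mball x (inverse (Suc n)) \<subseteq> U" if "x \<in> S" "y \<in> mball x (inverse (Suc n))" "y \<in> R" for x y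
    proof -
      have "mball x (inverse (Suc n)) \<subseteq> mball y \<epsilon>"
      proof
        fix z assume "z \<in> mball x (inverse (Suc n))"
        with that n show "z \<in> mball y \<epsilon>"
          using triangle[of y x z] commute[of x y] by auto
      qed
      with \<epsilon> that show ?thesis by (meson order_trans)
    qed
    then show ?thesis
      unfolding E_def by blast
  qed
  ultimately have "development X E"
    unfolding development_def by blast
  with that show thesis .
qed

text \<open>Each point \<open>x\<close> receives the intersection of its members of
  \<open>W 0\<close>, ..., \<open>W (N x)\<close>, where \<open>N x\<close> is the first level whose
  member fits into \<open>\<U>\<close>. All lower levels enter because the \<open>W n\<close> need
  not refine each other. If two such sets meet, their members agree up to the smaller level, where
  both already fit; so the levels agree and the sets coincide.\<close>

lemma zero_dim_in_of_fine_families: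
  assumes dev: "development X E"
    and W: "\<And>n. disjoint_open_refinement X (E n) (W n)" and C: "\<And>n. C \<subseteq> \<Union>(W n)"
  shows "zero_dim_in X C"
  unfolding zero_dim_in_def
proof (intro conjI allI impI; (elim conjE)?)
  show "C \<subseteq> topspace X"
    using W[of 0] C[of 0] openin_subset unfolding disjoint_open_refinement_def by blast
next
  fix \<U> assume \<U>: "\<forall>U\<in>\<U>. openin X U" "C \<subseteq> \<Union>\<U>"
  define V where "V = (\<lambda>n x. SOME v. v \<in> W n \<and> x \<in> v)"
  have V: "V n x \<in> W n" "x \<in> V n x" if "x \<in> C" for n x
  proof -
    have "\<exists>v. v \<in> W n \<and> x \<in> v" using C[of n] that by blast
    from someI_ex[OF this] show "V n x \<in> W n" "x \<in> V n x" unfolding V_def by auto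
  qed
  have V_eq: "V n x = V n y" if "x \<in> C" "y \<in> C" "z \<in> V n x" "z \<in> V n y" for n x y z
    using V that W[of n] unfolding disjoint_open_refinement_def disjoint_def by blast
  define P where "P = (\<lambda>x n. \<exists>U\<in>\<U>. V n x \<subseteq> U)"
  define N where "N = (\<lambda>x. LEAST n. P x n)"
  have "\<exists>n. P x n" if "x \<in> C" for x
  proof -
    have "x \<in> topspace X"
      using V[OF that] W[of 0] openin_subset unfolding disjoint_open_refinement_def by blast
    then have "compactin X {x}" "{x} \<subseteq> \<Union>\<U>" using \<U> that by auto
    then obtain n where n: "\<forall>v\<in>E n. v \<inter> {x} \<noteq> {} \<longrightarrow> (\<exists>U\<in>\<U>. v \<subseteq> U)"
      using dev \<U>(1) unfolding development_def by blast
    obtain e where "e \<in> E n" "V n x \<subseteq> e"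
      using V(1)[OF \<open>x \<in> C\<close>, of n] W[of n] unfolding disjoint_open_refinement_def refining_def by blast
    moreover from this V(2)[OF \<open>x \<in> C\<close>, of n] have "e \<inter> {x} \<noteq> {}" by blast
    ultimately obtain U where "U \<in> \<U>" "e \<subseteq> U" using n by blast
    with \<open>V n x \<subseteq> e\<close> show ?thesis
      unfolding P_def by blast
  qed
  then have N: "P x (N x)" "P x n \<Longrightarrow> N x \<le> n" if "x \<in> C" for x n
    using that unfolding N_def by (auto intro: LeastI_ex Least_le)
  define O' where "O' = (\<lambda>x. \<Inter>m\<le>N x. V m x)"
  have O'_eq: "O' x = O' y" if xy: "x \<in> C" "y \<in> C" "z \<in> O' x" "z \<in> O' y" "N x \<le> N y" for x y z
  proof -
    have eq: "V m x = V m y" if "m \<le> N x" for m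
      using V_eq[OF xy(1,2)] xy that unfolding O'_def by fastforce
    then have "N y \<le> N x"
      using N[OF xy(1)] N[OF xy(2)] unfolding P_def by metis
    with xy eq show ?thesis unfolding O'_def by auto
  qed
  have "disjoint (O' ` C)"
  proof (rule disjointI)
    fix A B assume "A \<in> O' ` C" "B \<in> O' ` C" "A \<noteq> B"
    then obtain x y where xy: "x \<in> C" "y \<in> C" "A = O' x" "B = O' y" by blast
    show "A \<inter> B = {}"
    proof (rule ccontr)
      assume "A \<inter> B \<noteq> {}"
      then obtain z where "z \<in> O' x" "z \<in> O' y" using xy by blast
      then have "O' x = O' y" using O'_eq[OF xy(1,2)] O'_eq[OF xy(2,1)] by (metis nle_le)
      with xy \<open>A \<noteq> B\<close> show False by blast
    qed
  qed
  moreover have "refining (O' ` C) \<U>"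
    unfolding refining_def
  proof safe
    fix x assume "x \<in> C"
    moreover have "O' x \<subseteq> V (N x) x" unfolding O'_def by blast
    ultimately show "\<exists>U\<in>\<U>. O' x \<subseteq> U" using N(1) unfolding P_def by (meson order_trans)
  qed
  moreover have "openin X (O' x)" if "x \<in> C" for x
  proof -
    have "openin X (V n x)" for n
      using V(1)[OF that, of n] W[of n] unfolding disjoint_open_refinement_def by blast
    then show ?thesis
      unfolding O'_def by (intro openin_Inter) auto
  qed
  moreover have "x \<in> O' x" if "x \<in> C" for x
    using V(2)[OF that] unfolding O'_def by blast
  then have "C \<subseteq> \<Union>(O' ` C)"
    by blast
  ultimately show "\<exists>\<V>. disjoint_open_refinement X \<U> \<V> \<and> C \<subseteq> \<Union>\<V>"
    unfolding disjoint_open_refinement_def by (intro exI[of _ "O' ` C"]) auto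
qed

text \<open>Heredity is not immediate, since open sets covering \<open>Z\<close> need not cover
  \<open>C\<close>. The covers of a development cover the whole space, so refinements obtained for
  \<open>C\<close> also serve \<open>Z\<close>.\<close>

lemma zero_dim_in_subset:
  assumes dev: "development X E" and C: "zero_dim_in X C" and Z: "Z \<subseteq> C"
  shows "zero_dim_in X Z"
proof -
  have "\<exists>\<V>. disjoint_open_refinement X (E n) \<V> \<and> C \<subseteq> \<Union>\<V>" for n
  proof -
    have "(\<forall>U\<in>E n. openin X U) \<and> C \<subseteq> \<Union>(E n)"
      using dev C unfolding development_def open_cover_def zero_dim_in_def by auto
    then show ?thesis using C unfolding zero_dim_in_def by metis
  qed
  then obtain W where W: "\<And>n. disjoint_open_refinement X (E n) (W n)" "\<And>n. C \<subseteq> \<Union>(W n)"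
    by metis
  have "Z \<subseteq> \<Union>(W n)" for n using W(2) Z by (rule order_trans[rotated])
  with dev W(1) show ?thesis by (rule zero_dim_in_of_fine_families)
qed

subsection \<open>Removing one dimension with a disjoint family\<close>

text \<open>
  In \<open>partition_stage X \<U> V C\<close> the sets \<open>V U\<close> form a disjoint family refining \<open>\<U>\<close>, labelled by \<open>\<U>\<close>
  itself so that successive stages can be compared, and \<open>C\<close> is a closed core that it covers.  A step
  trims the \<open>V U\<close> to a neighbourhood of \<open>C\<close> and attaches to them the members of one colour of a cover
  so fine that each meets at most one of them.  The new core contains all points that the remaining
  \<open>m\<close> colours miss.  In the limit, the complement of the union of the cores is covered by \<open>m\<close> colours of
  arbitrarily fine mesh.
\<close>
definition partition_stage :: "'a topology \<Rightarrow> 'a set set \<Rightarrow> ('a set \<Rightarrow> 'a set) \<Rightarrow> 'a set \<Rightarrow> bool" where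
  "partition_stage X \<U> V C \<longleftrightarrow>
     (\<forall>U\<in>\<U>. openin X (V U) \<and> V U \<subseteq> U) \<and> disjoint_family_on V \<U> \<and> closedin X C \<and> C \<subseteq> (\<Union>U\<in>\<U>. V U)"

lemma partition_step:
  assumes X: "normal_space X" and F: "closedin X F" "colour_cover X (Suc m) F"
    and \<U>: "\<forall>U\<in>\<U>. openin X U" "F \<subseteq> \<Union>\<U>" and \<E>: "\<forall>U\<in>\<E>. openin X U" "F \<subseteq> \<Union>\<E>"
    and VC: "partition_stage X \<U> V C"
  shows "\<exists>V' C' G \<T>. partition_stage X \<U> V' C' \<and> openin X G \<and> C \<subseteq> G \<and> G \<subseteq> C' \<and>
           (\<forall>U\<in>\<U>. V U \<inter> G \<subseteq> V' U) \<and>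
           (\<forall>j<m. disjoint_open_refinement X \<E> (\<T> j)) \<and> F - C' \<subseteq> (\<Union>j<m. \<Union>(\<T> j))"
proof -
  have V: "\<And>U. U \<in> \<U> \<Longrightarrow> openin X (V U)" "\<And>U. U \<in> \<U> \<Longrightarrow> V U \<subseteq> U" and disjV: "disjoint_family_on V \<U>"
    and C: "closedin X C" "C \<subseteq> (\<Union>U\<in>\<U>. V U)"
    using VC unfolding partition_stage_def by auto
  have "openin X (\<Union>U\<in>\<U>. V U)" using V(1) by blast
  with X C obtain H where H: "openin X H" "C \<subseteq> H" "X closure_of H \<subseteq> (\<Union>U\<in>\<U>. V U)"
    unfolding normal_space_alt by meson
  with X C obtain G where G: "openin X G" "C \<subseteq> G" "X closure_of G \<subseteq> H"
    unfolding normal_space_alt by meson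
  \<comment> \<open>Members of the first kind lie in a single \<open>V U\<close>, those of the
    second avoid the closure of \<open>H\<close>. Hence a set inside a member of \<open>\<A>\<close>
    that meets \<open>H\<close> lies in one \<open>V U\<close>, which determines its label.\<close>
  define \<A> where "\<A> = {E \<inter> V U |E U. E \<in> \<E> \<and> U \<in> \<U>} \<union> {E \<inter> U - X closure_of H |E U. E \<in> \<E> \<and> U \<in> \<U>}"
  have "\<forall>A\<in>\<A>. openin X A"
    using \<E>(1) \<U>(1) V(1) unfolding \<A>_def by (auto intro!: openin_Int openin_diff)
  moreover have "F \<subseteq> \<Union>\<A>"
  proof
    fix x assume x: "x \<in> F"
    obtain E U where "E \<in> \<E>" "x \<in> E" "U \<in> \<U>" "x \<in> U" using x \<E> \<U> by blast
    moreover have "\<exists>U\<in>\<U>. x \<in> V U" if "x \<in> X closure_of H" using that H by blast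
    ultimately show "x \<in> \<Union>\<A>" unfolding \<A>_def by blast
  qed
  ultimately obtain \<T> where \<T>: "\<forall>j<Suc m. disjoint_open_refinement X \<A> (\<T> j)" "F \<subseteq> (\<Union>j<Suc m. \<Union>(\<T> j))"
    using F(2) unfolding colour_cover_def by meson
  have "refining \<A> \<E>" unfolding refining_def \<A>_def by blast
  then have \<T>E: "\<forall>j<m. disjoint_open_refinement X \<E> (\<T> j)"
    using \<T>(1) unfolding disjoint_open_refinement_def refining_def by (meson less_SucI order_trans)
  have \<T>m: "disjoint (\<T> m)" "\<And>T. T \<in> \<T> m \<Longrightarrow> openin X T" "refining (\<T> m) \<A>"
    using \<T>(1) unfolding disjoint_open_refinement_def by auto
  have HH: "H \<subseteq> X closure_of H" using H(1) by (simp add: closure_of_subset openin_subset)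
  have "\<exists>U\<in>\<U>. T \<subseteq> U \<and> (T \<inter> H \<noteq> {} \<longrightarrow> T \<subseteq> V U)" if "T \<in> \<T> m" for T
  proof -
    obtain A where A: "A \<in> \<A>" "T \<subseteq> A"
      using \<T>m(3) \<open>T \<in> \<T> m\<close> unfolding refining_def by blast
    from A(1) consider E U where "U \<in> \<U>" "A = E \<inter> V U" | E U where "U \<in> \<U>" "A = E \<inter> U - X closure_of H"
      unfolding \<A>_def by blast
    then show ?thesis
    proof cases
      case 1 then show ?thesis using A(2) V(2)[of U] by blast
    next
      case 2 then show ?thesis using A(2) HH by blast
    qed
  qed
  then obtain lab where lab: "\<And>T. T \<in> \<T> m \<Longrightarrow> lab T \<in> \<U> \<and> T \<subseteq> lab T \<and> (T \<inter> H \<noteq> {} \<longrightarrow> T \<subseteq> V (lab T))"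
    by metis
  \<comment> \<open>Disjointness survives: a piece labelled \<open>U'\<close> either misses
    \<open>H\<close> or lies in \<open>V U'\<close>, which is disjoint from
    \<open>V U\<close>.\<close>
  define V' where "V' = (\<lambda>U. (V U \<inter> H) \<union> \<Union>{T \<in> \<T> m. lab T = U})"
  \<comment> \<open>The neighbourhood \<open>G\<close> leaves room between the old core and the new
    one. The points of \<open>F\<close> missed by the first \<open>m\<close> colours all lie in the
    colour with index \<open>m\<close>.\<close>
  define C' where "C' = X closure_of G \<union> (F - (\<Union>j<m. \<Union>(\<T> j)))"
  have "openin X (V' U)" if "U \<in> \<U>" for U
    unfolding V'_def using V(1)[OF that] H(1) \<T>m(2) by (intro openin_Un openin_Union openin_Int) auto
  moreover have "V' U \<subseteq> U" if "U \<in> \<U>" for U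
    unfolding V'_def using V(2)[OF that] lab by blast
  moreover have "V' U \<inter> V' U' = {}" if U: "U \<in> \<U>" "U' \<in> \<U>" "U \<noteq> U'" for U U'
  proof -
    have 1: "V U \<inter> V U' = {}" using disjV U unfolding disjoint_family_on_def by blast
    have 2: "T \<inter> T' = {}" if "T \<in> \<T> m" "T' \<in> \<T> m" "lab T = U" "lab T' = U'" for T T'
      using pairwiseD[OF \<T>m(1) that(1,2)] that U(3) unfolding disjnt_def by blast
    have 3: "V U \<inter> H \<inter> T = {}" if "T \<in> \<T> m" "lab T = U'" for T
      using lab[OF that(1)] that 1 by blast
    have 4: "V U' \<inter> H \<inter> T = {}" if "T \<in> \<T> m" "lab T = U" for T
      using lab[OF that(1)] that 1 by blast
    show ?thesis
    proof (rule ccontr)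
      assume "V' U \<inter> V' U' \<noteq> {}"
      then obtain x where x: "x \<in> V' U" "x \<in> V' U'" by blast
      from x(1) consider "x \<in> V U \<inter> H" | T where "T \<in> \<T> m" "lab T = U" "x \<in> T"
        unfolding V'_def by blast
      then show False
      proof cases
        case a: 1
        with x(2) 1 3 show False unfolding V'_def by blast
      next
        case b: 2
        with x(2) 2 4 show False unfolding V'_def by blast
      qed
    qed
  qed
  moreover have "closedin X C'"
    unfolding C'_def using F(1) \<T>E
    by (intro closedin_Un closedin_diff closedin_closure_of openin_Union) (auto simp: disjoint_open_refinement_def)
  moreover have "C' \<subseteq> (\<Union>U\<in>\<U>. V' U)"
  proof
    fix x assume "x \<in> C'"
    then consider "x \<in> H" | "x \<in> F - (\<Union>j<m. \<Union>(\<T> j))" unfolding C'_def using G(3) by blast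
    then show "x \<in> (\<Union>U\<in>\<U>. V' U)"
    proof cases
      case 1 then show ?thesis using HH H(3) unfolding V'_def by blast
    next
      case 2
      then obtain T where "T \<in> \<T> m" "x \<in> T" using \<T>(2) by (auto simp: lessThan_Suc)
      then show ?thesis using lab[of T] unfolding V'_def by blast
    qed
  qed
  ultimately have "partition_stage X \<U> V' C'"
    unfolding partition_stage_def disjoint_family_on_def by blast
  moreover have "G \<subseteq> X closure_of G" using G(1) by (simp add: closure_of_subset openin_subset)
  then have "G \<subseteq> C'" "G \<subseteq> H" using G(3) unfolding C'_def by auto
  moreover have "\<forall>U\<in>\<U>. V U \<inter> G \<subseteq> V' U" using \<open>G \<subseteq> H\<close> unfolding V'_def by blast
  moreover have "F - C' \<subseteq> (\<Union>j<m. \<Union>(\<T> j))" unfolding C'_def by blast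
  ultimately show ?thesis using G \<T>E by blast
qed

text \<open>The construction only sees the covers \<open>E n\<close>, yet every cover of the
  remainder is handled: the remainder is compact, so some \<open>E n\<close> refines the cover near
  it, and the part of \<open>F\<close> outside the core of stage \<open>n + 1\<close> is covered by
  \<open>m\<close> colours refining \<open>E n\<close>.\<close>

lemma colour_cover_partition:
  assumes X: "compact_space X" "normal_space X" and dev: "development X E"
    and F: "closedin X F" "colour_cover X (Suc m) F"
    and \<U>: "\<forall>U\<in>\<U>. openin X U" "F \<subseteq> \<Union>\<U>"
  shows "\<exists>\<V>. disjoint_open_refinement X \<U> \<V> \<and> colour_cover X m (F - \<Union>\<V>)"
proof -
  have E: "\<forall>U\<in>E n. openin X U" "F \<subseteq> \<Union>(E n)" for n
    using dev closedin_subset[OF F(1)] unfolding development_def open_cover_def by auto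
  define next_stage where "next_stage = (\<lambda>n p q. \<exists>G \<T>. openin X G \<and> snd p \<subseteq> G \<and> G \<subseteq> snd q \<and>
           (\<forall>U\<in>\<U>. fst p U \<inter> G \<subseteq> fst q U) \<and>
           (\<forall>j<m. disjoint_open_refinement X (E n) (\<T> j)) \<and> F - snd q \<subseteq> (\<Union>j<m. \<Union>(\<T> j)))"
  have "\<exists>f. \<forall>n. partition_stage X \<U> (fst (f n)) (snd (f n)) \<and> next_stage n (f n) (f (Suc n))"
  proof (rule dependent_nat_choice)
    have "partition_stage X \<U> (\<lambda>_. {}) {}"
      unfolding partition_stage_def disjoint_family_on_def by auto
    then show "\<exists>p. partition_stage X \<U> (fst p) (snd p)" by (metis fst_conv snd_conv)
  next
    fix p n assume "partition_stage X \<U> (fst p) (snd p)"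
    from partition_step[OF X(2) F \<U> E this]
    obtain V' C' where "partition_stage X \<U> V' C'" "next_stage n p (V', C')"
      unfolding next_stage_def fst_conv snd_conv by metis
    then show "\<exists>q. partition_stage X \<U> (fst q) (snd q) \<and> next_stage n p q" by (metis fst_conv snd_conv)
  qed
  then obtain f where f: "\<And>n. partition_stage X \<U> (fst (f n)) (snd (f n))" "\<And>n. next_stage n (f n) (f (Suc n))"
    by blast
  define V where "V = (\<lambda>n. fst (f n))"
  define C where "C = (\<lambda>n. snd (f n))"
  have V: "\<And>n U. U \<in> \<U> \<Longrightarrow> openin X (V n U)" "\<And>n U. U \<in> \<U> \<Longrightarrow> V n U \<subseteq> U"
    "\<And>n U U'. U \<in> \<U> \<Longrightarrow> U' \<in> \<U> \<Longrightarrow> U \<noteq> U' \<Longrightarrow> V n U \<inter> V n U' = {}"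
    and C: "\<And>n. closedin X (C n)" "\<And>n. C n \<subseteq> (\<Union>U\<in>\<U>. V n U)"
    using f(1) unfolding V_def C_def partition_stage_def disjoint_family_on_def by blast+
  obtain G where G: "\<And>n. openin X (G n)" "\<And>n. C n \<subseteq> G n" "\<And>n. G n \<subseteq> C (Suc n)"
    "\<And>n U. U \<in> \<U> \<Longrightarrow> V n U \<inter> G n \<subseteq> V (Suc n) U"
    and \<T>: "\<And>n. \<exists>\<T>. (\<forall>j<m. disjoint_open_refinement X (E n) (\<T> j)) \<and> F - C (Suc n) \<subseteq> (\<Union>j<m. \<Union>(\<T> j))"
    using f(2) unfolding next_stage_def V_def C_def by metis
  \<comment> \<open>The part of \<open>V n U\<close> inside \<open>G n\<close> survives every later
    trimming. These parts increase with \<open>n\<close>, which keeps the unions disjoint, and they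
    still cover every core.\<close>
  define W where "W = (\<lambda>U. \<Union>n. V n U \<inter> G n)"
  have mono: "V n U \<inter> G n \<subseteq> V k U \<inter> G k" if "U \<in> \<U>" "n \<le> k" for n k U
    using that(2)
  proof (induction rule: dec_induct)
    case (step k)
    then show ?case using G(2)[of "Suc k"] G(3)[of k] G(4)[OF that(1), of k] by blast
  qed auto
  have W: "openin X (W U)" "W U \<subseteq> U" if "U \<in> \<U>" for U
    using V[OF that] G(1) that unfolding W_def by (auto intro!: openin_Union)
  have disjW: "W U \<inter> W U' = {}" if "U \<in> \<U>" "U' \<in> \<U>" "U \<noteq> U'" for U U'
  proof (rule ccontr)
    assume "W U \<inter> W U' \<noteq> {}"
    then obtain x n n' where "x \<in> V n U \<inter> G n" "x \<in> V n' U' \<inter> G n'" unfolding W_def by blast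
    then have "x \<in> V (max n n') U" "x \<in> V (max n n') U'"
      using mono[OF that(1), of n "max n n'"] mono[OF that(2), of n' "max n n'"] by auto
    with V(3)[OF that] show False by blast
  qed
  have C_sub: "C n \<subseteq> (\<Union>U\<in>\<U>. W U)" for n
  proof
    fix x assume x: "x \<in> C n"
    then obtain U where "U \<in> \<U>" "x \<in> V n U" using C(2) by blast
    moreover have "x \<in> G n" using G(2) x by blast
    ultimately show "x \<in> (\<Union>U\<in>\<U>. W U)" unfolding W_def by blast
  qed
  have "disjoint (W ` \<U>)"
    unfolding disjoint_def using disjW by (metis (no_types, lifting) imageE)
  then have "disjoint_open_refinement X \<U> (W ` \<U>)"
    unfolding disjoint_open_refinement_def refining_def using W by blast
  moreover have "colour_cover X m (F - (\<Union>U\<in>\<U>. W U))"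
    unfolding colour_cover_def
  proof (intro allI impI, elim conjE)
    fix \<A> assume \<A>: "\<forall>U\<in>\<A>. openin X U" "F - (\<Union>U\<in>\<U>. W U) \<subseteq> \<Union>\<A>"
    define R where "R = F - (\<Union>U\<in>\<U>. W U)"
    have "closedin X R"
      unfolding R_def using W(1) by (intro closedin_diff F(1) openin_Union) blast
    then have "compactin X R" using X(1) closedin_compact_space by blast
    then obtain n where n: "\<forall>v\<in>E n. v \<inter> R \<noteq> {} \<longrightarrow> (\<exists>U\<in>\<A>. v \<subseteq> U)"
      using dev \<A> unfolding development_def R_def[symmetric] by blast
    obtain \<T> where \<T>: "\<forall>j<m. disjoint_open_refinement X (E n) (\<T> j)" "F - C (Suc n) \<subseteq> (\<Union>j<m. \<Union>(\<T> j))"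
      using \<T> by meson
    \<comment> \<open>Members missing \<open>R\<close> are dropped, since \<open>E n\<close> is
      known to refine \<open>\<A>\<close> only near \<open>R\<close>.\<close>
    define \<V> where "\<V> = (\<lambda>j. {T \<in> \<T> j. T \<inter> R \<noteq> {}})"
    have "disjoint_open_refinement X \<A> (\<V> j)" if "j < m" for j
    proof -
      have "disjoint (\<T> j)" "refining (\<T> j) (E n)" "\<forall>V\<in>\<T> j. openin X V"
        using \<T>(1) that unfolding disjoint_open_refinement_def by auto
      moreover have "refining (\<V> j) \<A>"
        unfolding refining_def
      proof
        fix T assume T: "T \<in> \<V> j"
        then obtain e where "e \<in> E n" "T \<subseteq> e" "T \<inter> R \<noteq> {}"
          using \<open>refining (\<T> j) (E n)\<close> unfolding refining_def \<V>_def by blast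
        moreover from this have "e \<inter> R \<noteq> {}" by blast
        ultimately obtain U where "U \<in> \<A>" "e \<subseteq> U" using n by blast
        with \<open>T \<subseteq> e\<close> show "\<exists>U\<in>\<A>. T \<subseteq> U" by blast
      qed
      moreover have "\<V> j \<subseteq> \<T> j" unfolding \<V>_def by blast
      ultimately show ?thesis
        unfolding disjoint_open_refinement_def by (meson pairwise_subset subsetD)
    qed
    moreover have "R \<subseteq> (\<Union>j<m. \<Union>(\<V> j))"
    proof
      fix x assume x: "x \<in> R"
      then have "x \<in> F - C (Suc n)" using C_sub unfolding R_def by blast
      then show "x \<in> (\<Union>j<m. \<Union>(\<V> j))" using \<T>(2) x unfolding \<V>_def by blast
    qed
    ultimately show "\<exists>\<V>. (\<forall>j<m. disjoint_open_refinement X \<A> (\<V> j)) \<and> F - (\<Union>U\<in>\<U>. W U) \<subseteq> (\<Union>j<m. \<Union>(\<V> j))"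
      unfolding R_def by blast
  qed
  ultimately show ?thesis by blast
qed

text \<open>For each \<open>n\<close>, one disjoint family refining \<open>E n\<close> leaves a
  closed set that needs one colour less. A point missed by some family falls under the induction
  hypothesis; the points lying in all families form a zero-dimensional set, because the families are
  arbitrarily fine.\<close>

lemma colour_cover_imp_countable_dim:
  assumes X: "compact_space X" "normal_space X" and dev: "development X E"
    and "closedin X F" "colour_cover X m F"
  shows "countable_dim_in X F"
  using assms(4,5)
proof (induction m arbitrary: F)
  case 0
  have "(\<forall>U\<in>{topspace X}. openin X U) \<and> F \<subseteq> \<Union>{topspace X}"
    using closedin_subset[OF 0(1)] by simp
  with 0(2) have "F = {}" unfolding colour_cover_def by (metis (no_types, lifting) lessThan_0 SUP_empty subset_empty)
  then show ?case using zero_dim_imp_countable_dim[OF zero_dim_in_empty] by auto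
next
  case (Suc m)
  have "\<exists>\<V>. disjoint_open_refinement X (E n) \<V> \<and> colour_cover X m (F - \<Union>\<V>)" for n
  proof -
    have "\<forall>U\<in>E n. openin X U" "F \<subseteq> \<Union>(E n)"
      using dev closedin_subset[OF Suc.prems(1)] unfolding development_def open_cover_def by auto
    then show ?thesis by (rule colour_cover_partition[OF X dev Suc.prems])
  qed
  then obtain \<V> where \<V>: "\<And>n. disjoint_open_refinement X (E n) (\<V> n)" "\<And>n. colour_cover X m (F - \<Union>(\<V> n))"
    by metis
  have "closedin X (F - \<Union>(\<V> n))" for n
    using \<V>(1)[of n] unfolding disjoint_open_refinement_def
    by (intro closedin_diff Suc.prems(1) openin_Union) blast
  then have "countable_dim_in X (F - \<Union>(\<V> n))" for n
    using Suc.IH \<V>(2) by blast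
  moreover have "zero_dim_in X (\<Inter>n. \<Union>(\<V> n))"
    by (rule zero_dim_in_of_fine_families[OF dev \<V>(1)]) auto
  then have "countable_dim_in X (\<Inter>n. \<Union>(\<V> n))"
    by (rule zero_dim_imp_countable_dim)
  ultimately have "countable_dim_in X (\<Union>(insert (\<Inter>n. \<Union>(\<V> n)) (range (\<lambda>n. F - \<Union>(\<V> n)))))"
    by (intro countable_dim_in_Union) auto
  moreover have "F \<subseteq> \<Union>(insert (\<Inter>n. \<Union>(\<V> n)) (range (\<lambda>n. F - \<Union>(\<V> n))))"
    by auto
  ultimately show ?case
    by (rule countable_dim_in_mono)
qed

subsection \<open>Covering dimension and totally disconnected compacta\<close>

text \<open>
  Given functions \<open>f v\<close> supported in the members \<open>v\<close> of a cover of order at most \<open>n + 1\<close>, the set \<open>W S\<close>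
  where the functions indexed by \<open>S\<close> are positive and dominate all the others gets the colour \<open>card S\<close>.
  Two sets of the same colour are disjoint, and \<open>x \<in> W {v. 0 < f v x}\<close>.
\<close>
lemma covering_dim_le_imp_colour_cover:
  assumes X: "normal_space X" "regular_space X" and L: "compactin X L"
    and dim: "covering_dim_le (subtopology X L) n"
  shows "colour_cover X (nat (n + 1)) L"
  unfolding colour_cover_def
proof (intro allI impI, elim conjE)
  fix \<U> assume \<U>: "\<forall>U\<in>\<U>. openin X U" "L \<subseteq> \<Union>\<U>"
  have LX: "L \<subseteq> topspace X" using L compactin_subset_topspace by blast
  obtain \<U>0 where \<U>0: "finite \<U>0" "\<U>0 \<subseteq> \<U>" "L \<subseteq> \<Union>\<U>0"
    using compactinD[OF L] \<U> by meson
  have "open_cover (subtopology X L) ((\<inter>) L ` \<U>0)"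
    unfolding open_cover_def using \<U> \<U>0 LX by (auto simp: openin_subtopology_Int2)
  moreover have "finite ((\<inter>) L ` \<U>0)" using \<U>0 by blast
  ultimately obtain \<V> where \<V>: "finite \<V>" "open_cover (subtopology X L) \<V>" "refining \<V> ((\<inter>) L ` \<U>0)"
    and ord: "\<forall>x\<in>topspace (subtopology X L). int (card {V \<in> \<V>. x \<in> V}) \<le> n + 1"
    using dim unfolding covering_dim_le_def by blast
  have "\<exists>G. openin X G \<and> V = L \<inter> G \<and> (\<exists>U\<in>\<U>. G \<subseteq> U)" if V: "V \<in> \<V>" for V
  proof -
    obtain T where T: "openin X T" "V = T \<inter> L"
      using \<V>(2) V unfolding open_cover_def openin_subtopology by blast
    obtain U where U: "U \<in> \<U>0" "V \<subseteq> L \<inter> U"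
      using \<V>(3) V unfolding refining_def by blast
    have "openin X (T \<inter> U)" "V = L \<inter> (T \<inter> U)" "T \<inter> U \<subseteq> U" "U \<in> \<U>"
      using T U \<U> \<U>0 by (blast intro: openin_Int)+
    then show ?thesis by blast
  qed
  then obtain G where G: "\<And>V. V \<in> \<V> \<Longrightarrow> openin X (G V)" "\<And>V. V \<in> \<V> \<Longrightarrow> V = L \<inter> G V"
    "\<And>V. V \<in> \<V> \<Longrightarrow> \<exists>U\<in>\<U>. G V \<subseteq> U"
    by metis
  \<comment> \<open>The cover is shrunk before Urysohn's lemma: finitely many open sets with
    closures inside the \<open>G V\<close> cover \<open>L\<close>, and grouping those closures by
    \<open>V\<close> gives closed sets \<open>F V\<close> inside \<open>G V\<close> that still cover
    \<open>L\<close>.\<close>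
  define \<H> where "\<H> = {H. openin X H \<and> (\<exists>V\<in>\<V>. X closure_of H \<subseteq> G V)}"
  have "L \<subseteq> \<Union>\<H>"
  proof
    fix x assume x: "x \<in> L"
    then obtain V where V: "V \<in> \<V>" "x \<in> G V"
      using \<V>(2) LX G(2) unfolding open_cover_def by (metis (no_types, lifting) IntE UnionE inf.absorb_iff2 topspace_subtopology)
    then obtain H C where "openin X H" "closedin X C" "x \<in> H" "H \<subseteq> C" "C \<subseteq> G V"
      using X(2) G(1)[OF V(1)] unfolding neighbourhood_base_of_closedin[symmetric] neighbourhood_base_of
      by meson
    then have "X closure_of H \<subseteq> G V" by (meson closure_of_minimal order_trans)
    then show "x \<in> \<Union>\<H>" using \<open>openin X H\<close> \<open>x \<in> H\<close> V unfolding \<H>_def by blast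
  qed
  then obtain \<H>0 where \<H>0: "finite \<H>0" "\<H>0 \<subseteq> \<H>" "L \<subseteq> \<Union>\<H>0"
    using compactinD[OF L, of \<H>] unfolding \<H>_def by blast
  define F where "F = (\<lambda>V. \<Union>H\<in>{H\<in>\<H>0. X closure_of H \<subseteq> G V}. X closure_of H)"
  have "\<exists>f. continuous_map X (top_of_set {0..1::real}) f \<and> f ` (topspace X - G V) \<subseteq> {0} \<and> f ` F V \<subseteq> {1}"
    if V: "V \<in> \<V>" for V
  proof -
    have "closedin X (F V)" unfolding F_def using \<H>0(1) by (intro closedin_Union) auto
    moreover have "closedin X (topspace X - G V)" using G(1)[OF V] by blast
    moreover have "disjnt (topspace X - G V) (F V)" unfolding F_def disjnt_def by blast
    ultimately show ?thesis using Urysohn_lemma[OF X(1), of "topspace X - G V" "F V" 0 1] by (metis zero_le_one)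
  qed
  then obtain f where f: "\<And>V. V \<in> \<V> \<Longrightarrow> continuous_map X (top_of_set {0..1::real}) (f V)"
    "\<And>V. V \<in> \<V> \<Longrightarrow> f V ` (topspace X - G V) \<subseteq> {0}" "\<And>V. V \<in> \<V> \<Longrightarrow> f V ` F V \<subseteq> {1}"
    by metis
  have cont: "continuous_map X euclideanreal (f V)" and nonneg: "x \<in> topspace X \<Longrightarrow> 0 \<le> f V x" if "V \<in> \<V>" for V x
    using f(1)[OF that] by (auto simp: continuous_map_in_subtopology)
  have pos_imp: "x \<in> G V" if "V \<in> \<V>" "x \<in> topspace X" "0 < f V x" for V x
    using f(2)[OF that(1)] that by fastforce
  define W where "W = (\<lambda>S. {x \<in> topspace X. \<forall>v\<in>S. 0 < f v x \<and> (\<forall>w\<in>\<V> - S. f w x < f v x)})"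
  have openW: "openin X (W S)" if "S \<subseteq> \<V>" for S
  proof -
    have fin: "finite S" using that \<V>(1) finite_subset by blast
    have "openin X {x \<in> topspace X. f v x \<in> {0<..}}" if "v \<in> S" for v
      using that \<open>S \<subseteq> \<V>\<close> by (intro openin_continuous_map_preimage[OF cont]) auto
    then have 1: "openin X ((\<Inter>v\<in>S. {x \<in> topspace X. f v x \<in> {0<..}}) \<inter> topspace X)"
      using fin by (intro openin_INT) auto
    have "openin X {x \<in> topspace X. f v x - f w x \<in> {0<..}}" if "v \<in> S" "w \<in> \<V> - S" for v w
      using that \<open>S \<subseteq> \<V>\<close> by (intro openin_continuous_map_preimage[OF continuous_map_diff[OF cont cont]]) auto
    then have 2: "openin X ((\<Inter>p\<in>S \<times> (\<V> - S). {x \<in> topspace X. f (fst p) x - f (snd p) x \<in> {0<..}}) \<inter> topspace X)"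
      using fin \<V>(1) by (intro openin_INT) auto
    have "W S = ((\<Inter>v\<in>S. {x \<in> topspace X. f v x \<in> {0<..}}) \<inter> topspace X) \<inter>
        ((\<Inter>p\<in>S \<times> (\<V> - S). {x \<in> topspace X. f (fst p) x - f (snd p) x \<in> {0<..}}) \<inter> topspace X)"
      unfolding W_def by auto
    then show ?thesis using openin_Int[OF 1 2] by simp
  qed
  have disjW: "W S \<inter> W S' = {}" if S: "S \<subseteq> \<V>" "S' \<subseteq> \<V>" "card S = card S'" "S \<noteq> S'" for S S'
  proof (rule ccontr)
    assume "W S \<inter> W S' \<noteq> {}"
    then obtain x where x: "x \<in> W S" "x \<in> W S'" by blast
    have "finite S" "finite S'" using S \<V>(1) finite_subset by blast+
    then have "\<not> S \<subseteq> S'" "\<not> S' \<subseteq> S" using S by (metis card_subset_eq)+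
    then obtain v w where "v \<in> S - S'" "w \<in> S' - S" by blast
    then have "f w x < f v x" "f v x < f w x" using x S unfolding W_def by blast+
    then show False by simp
  qed
  \<comment> \<open>Colour \<open>j\<close> collects index sets of size \<open>j + 1\<close>. The
    empty index set is excluded because \<open>W {}\<close> is the whole space, which need not fit
    into a member of \<open>\<U>\<close>.\<close>
  define \<W> where "\<W> = (\<lambda>j. W ` {S. S \<subseteq> \<V> \<and> card S = Suc j})"
  have "disjoint_open_refinement X \<U> (\<W> j)" for j
    unfolding disjoint_open_refinement_def
  proof (intro conjI ballI)
    show "disjoint (\<W> j)"
    proof (rule disjointI)
      fix A B assume "A \<in> \<W> j" "B \<in> \<W> j" "A \<noteq> B"
      obtain S where S: "A = W S" "S \<subseteq> \<V>" "card S = Suc j"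
        using \<open>A \<in> \<W> j\<close> unfolding \<W>_def by blast
      obtain S' where S': "B = W S'" "S' \<subseteq> \<V>" "card S' = Suc j"
        using \<open>B \<in> \<W> j\<close> unfolding \<W>_def by blast
      show "A \<inter> B = {}" using disjW[of S S'] S S' \<open>A \<noteq> B\<close> by metis
    qed
    show "refining (\<W> j) \<U>"
      unfolding refining_def
    proof
      fix A assume "A \<in> \<W> j"
      then obtain S where S: "A = W S" "S \<subseteq> \<V>" "card S = Suc j" unfolding \<W>_def by blast
      then obtain v where "v \<in> S" by fastforce
      then have "v \<in> \<V>" "A \<subseteq> G v" using S pos_imp unfolding W_def by blast+
      then show "\<exists>U\<in>\<U>. A \<subseteq> U" using G(3) by (meson order_trans)
    qed
  next
    fix A assume "A \<in> \<W> j"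
    then show "openin X A" using openW unfolding \<W>_def by blast
  qed
  moreover have "L \<subseteq> (\<Union>j<nat (n + 1). \<Union>(\<W> j))"
  proof
    fix x assume x: "x \<in> L"
    define S where "S = {v \<in> \<V>. 0 < f v x}"
    obtain H where H: "H \<in> \<H>0" "x \<in> H" using x \<H>0 by blast
    then obtain v where v: "v \<in> \<V>" "X closure_of H \<subseteq> G v" and "openin X H" using \<H>0(2) unfolding \<H>_def by blast
    then have "x \<in> X closure_of H" using H(2) by (meson closure_of_subset openin_subset subsetD)
    then have "x \<in> F v" using v H unfolding F_def by blast
    then have "f v x = 1" using f(3)[OF v(1)] by blast
    then have "v \<in> S" using v unfolding S_def by simp
    \<comment> \<open>On \<open>L\<close> the sets \<open>G V\<close> and \<open>V\<close> agree, so
      the order of \<open>\<V>\<close> bounds the number of functions positive at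
      \<open>x\<close>.\<close>
    have sub: "S \<subseteq> {V \<in> \<V>. x \<in> V}" using pos_imp G(2) x LX unfolding S_def by blast
    moreover have "finite {V \<in> \<V>. x \<in> V}" using \<V>(1) by simp
    ultimately have "card S \<le> card {V \<in> \<V>. x \<in> V}" "finite S" by (auto intro: card_mono finite_subset)
    moreover have "int (card {V \<in> \<V>. x \<in> V}) \<le> n + 1" using ord x LX by auto
    moreover have "card S \<noteq> 0" using \<open>v \<in> S\<close> \<open>finite S\<close> by auto
    ultimately have "card S = Suc (card S - 1)" "card S - 1 < nat (n + 1)" by linarith+
    moreover have "x \<in> W S"
      unfolding W_def
    proof (intro CollectI conjI ballI)
      show "x \<in> topspace X" using x LX by blast
    next
      fix v assume "v \<in> S" then show "0 < f v x" unfolding S_def by simp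
    next
      fix v w assume vw: "v \<in> S" "w \<in> \<V> - S"
      then have "0 < f v x" "\<not> 0 < f w x" unfolding S_def by auto
      then show "f w x < f v x" by linarith
    qed
    moreover have "S \<subseteq> \<V>" unfolding S_def by blast
    ultimately show "x \<in> (\<Union>j<nat (n + 1). \<Union>(\<W> j))" unfolding \<W>_def by blast
  qed
  ultimately show "\<exists>\<V>. (\<forall>j<nat (n + 1). disjoint_open_refinement X \<U> (\<V> j)) \<and> L \<subseteq> (\<Union>j<nat (n + 1). \<Union>(\<V> j))"
    by blast
qed

text \<open>In the compact Hausdorff space \<open>R\<close>, components are quasi-components, so
  some relatively clopen \<open>P\<close> contains \<open>x\<close> and lies in \<open>U\<close>.
  Normality separates \<open>P\<close> from \<open>R - P\<close> by open sets of \<open>X\<close>,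
  and the one around \<open>P\<close>, cut down to \<open>U\<close>, is \<open>G\<close>. The last
  condition says that the boundary of \<open>G\<close> misses \<open>R\<close>.\<close>

lemma totally_disconnected_compact_small_neighbourhood:
  assumes X: "normal_space X" "Hausdorff_space X" and R: "compactin X R"
    and td: "totally_disconnected_space (subtopology X R)"
    and x: "x \<in> R" "openin X U" "x \<in> U"
  shows "\<exists>G. openin X G \<and> x \<in> G \<and> G \<subseteq> U \<and> R \<inter> X closure_of G \<subseteq> G"
proof -
  have RX: "R \<subseteq> topspace X" using R compactin_subset_topspace by blast
  define Y where "Y = subtopology X R"
  have Y: "compact_space Y" "Hausdorff_space Y" "topspace Y = R"
    unfolding Y_def using R X(2) RX by (auto simp: compact_space_subtopology Hausdorff_space_subtopology)
  have "connectedin Y (connected_component_of_set Y x)" by (rule connectedin_connected_component_of)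
  then obtain a where "connected_component_of_set Y x \<subseteq> {a}"
    using td unfolding totally_disconnected_space_def Y_def by blast
  moreover have "x \<in> connected_component_of_set Y x"
    using x Y by (simp add: connected_component_of_refl)
  ultimately have comp: "connected_component_of_set Y x = {x}" by blast
  have xC: "{x} \<in> connected_components_of Y"
    using comp x Y(3) unfolding connected_components_of_def by (metis imageI)
  have "closedin Y (R - U)"
    using x(2) Y(3) unfolding Y_def by (metis closedin_diff closedin_topspace openin_subtopology_Int2 Diff_Int_distrib Diff_Int2 inf.idem Diff_Int Diff_cancel sup_bot_left)
  moreover have "compactin Y {x}" using x Y by simp
  ultimately have "separated_between Y {x} (R - U)"
    using separated_between_compact_connected_component[OF _ Y(2) xC, of "R - U"] Y(1) x
    by (simp add: compact_imp_locally_compact_space)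
  then obtain P where P: "closedin Y P" "openin Y P" "{x} \<subseteq> P" "R - U \<subseteq> R - P"
    unfolding separated_between Y(3) by blast
  have PR: "P \<subseteq> R" using P(1) Y(3) closedin_subset by blast
  have cR: "closedin X R" using R X(2) compactin_imp_closedin by blast
  have "closedin X P" using P(1) cR unfolding Y_def by (meson closedin_trans_full)
  moreover have "closedin Y (R - P)" using P(2) Y(3) by (metis closedin_diff closedin_topspace)
  then have "closedin X (R - P)" using cR unfolding Y_def by (meson closedin_trans_full)
  ultimately obtain A B where AB: "openin X A" "openin X B" "P \<subseteq> A" "R - P \<subseteq> B" "disjnt A B"
    using X(1) unfolding normal_space_def by (metis Diff_disjoint disjnt_def)
  define G where "G = A \<inter> U"
  have "B \<inter> X closure_of G = {}"
  proof -
    have "B \<inter> G = {}" using AB(5) unfolding G_def disjnt_def by blast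
    then show ?thesis using AB(2) by (simp add: openin_Int_closure_of_eq_empty)
  qed
  then have "R \<inter> X closure_of G \<subseteq> P" using AB(4) by blast
  also have "P \<subseteq> G" using P PR AB(3) unfolding G_def by blast
  finally have "R \<inter> X closure_of G \<subseteq> G" .
  moreover have "openin X G" "x \<in> G" "G \<subseteq> U"
    unfolding G_def using AB x P by auto
  ultimately show ?thesis by blast
qed

text \<open>A new \<open>G\<close> is kept whole and its closure is removed from the sets built
  before. No point of \<open>R\<close> is lost, because inside \<open>R\<close> the closure adds
  nothing to \<open>G\<close>.\<close>

lemma disjoint_refinement_of_finite_cover:
  assumes "finite \<G>" "\<And>G. G \<in> \<G> \<Longrightarrow> openin X G \<and> R \<inter> X closure_of G \<subseteq> G"
  shows "\<exists>\<V>. disjoint_open_refinement X \<G> \<V> \<and> R \<inter> \<Union>\<G> \<subseteq> \<Union>\<V>"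
  using assms
proof (induction \<G>)
  case empty
  show ?case unfolding disjoint_open_refinement_def refining_def by (intro exI[of _ "{}"]) auto
next
  case (insert G \<G>)
  then obtain \<V> where \<V>: "disjoint_open_refinement X \<G> \<V>" "R \<inter> \<Union>\<G> \<subseteq> \<Union>\<V>" by auto
  have G: "openin X G" "R \<inter> X closure_of G \<subseteq> G" "G \<subseteq> X closure_of G"
    using insert.prems[of G] closure_of_subset[OF openin_subset, of X G] by auto
  have d: "disjoint \<V>" "refining \<V> \<G>" "\<And>V. V \<in> \<V> \<Longrightarrow> openin X V"
    using \<V>(1) unfolding disjoint_open_refinement_def by auto
  define \<V>' where "\<V>' = insert G ((\<lambda>V. V - X closure_of G) ` \<V>)"
  have "disjoint \<V>'"
  proof (rule disjointI)
    fix A B assume AB: "A \<in> \<V>'" "B \<in> \<V>'" "A \<noteq> B"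
    then consider "A = G" "\<exists>V\<in>\<V>. B = V - X closure_of G" | "B = G" "\<exists>V\<in>\<V>. A = V - X closure_of G"
      | V W where "V \<in> \<V>" "W \<in> \<V>" "A = V - X closure_of G" "B = W - X closure_of G"
      unfolding \<V>'_def by blast
    then show "A \<inter> B = {}"
    proof cases
      case 3
      then have "V \<noteq> W" using AB by blast
      with d(1) 3 have "V \<inter> W = {}" by (metis disjointD)
      with 3 show ?thesis by blast
    qed (use G(3) in blast)+
  qed
  moreover have "refining \<V>' (insert G \<G>)"
    unfolding refining_def
  proof
    fix A assume "A \<in> \<V>'"
    then consider "A = G" | V where "V \<in> \<V>" "A \<subseteq> V" unfolding \<V>'_def by blast
    then show "\<exists>U\<in>insert G \<G>. A \<subseteq> U"
      using d(2) unfolding refining_def by cases (blast, meson insertI2 order_trans)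
  qed
  moreover have "\<forall>V\<in>\<V>'. openin X V"
    using G(1) d(3) unfolding \<V>'_def by (auto intro!: openin_diff)
  moreover have "R \<inter> \<Union>(insert G \<G>) \<subseteq> \<Union>\<V>'"
  proof
    fix x assume x: "x \<in> R \<inter> \<Union>(insert G \<G>)"
    show "x \<in> \<Union>\<V>'"
    proof (cases "x \<in> X closure_of G")
      case True
      then have "x \<in> G" using x G(2) by blast
      then show ?thesis unfolding \<V>'_def by blast
    next
      case False
      then have "x \<in> R \<inter> \<Union>\<G>" using x G(3) by auto
      then obtain V where "V \<in> \<V>" "x \<in> V" using \<V>(2) by auto
      then have "x \<in> V - X closure_of G" "V - X closure_of G \<in> \<V>'"
        using False unfolding \<V>'_def by auto
      then show ?thesis by (rule UnionI[rotated])
    qed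
  qed
  ultimately show ?case unfolding disjoint_open_refinement_def by blast
qed

lemma totally_disconnected_compact_imp_zero_dim:
  assumes X: "normal_space X" "Hausdorff_space X" and R: "compactin X R"
    and td: "totally_disconnected_space (subtopology X R)"
  shows "zero_dim_in X R"
  unfolding zero_dim_in_def
proof (intro conjI allI impI; (elim conjE)?)
  show "R \<subseteq> topspace X" using R by (rule compactin_subset_topspace)
next
  fix \<U> assume \<U>: "\<forall>U\<in>\<U>. openin X U" "R \<subseteq> \<Union>\<U>"
  define \<G> where "\<G> = {G. openin X G \<and> (\<exists>U\<in>\<U>. G \<subseteq> U) \<and> R \<inter> X closure_of G \<subseteq> G}"
  have "R \<subseteq> \<Union>\<G>"
  proof
    fix x assume x: "x \<in> R"
    then obtain U where "U \<in> \<U>" "x \<in> U" using \<U>(2) by blast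
    with totally_disconnected_compact_small_neighbourhood[OF X R td x, of U] \<U>(1)
    show "x \<in> \<Union>\<G>" unfolding \<G>_def by blast
  qed
  then obtain \<G>0 where \<G>0: "finite \<G>0" "\<G>0 \<subseteq> \<G>" "R \<subseteq> \<Union>\<G>0"
    using compactinD[OF R, of \<G>] unfolding \<G>_def by blast
  have small: "openin X G \<and> R \<inter> X closure_of G \<subseteq> G" if "G \<in> \<G>0" for G
    using \<G>0(2) that unfolding \<G>_def by blast
  have "\<exists>\<V>. disjoint_open_refinement X \<G>0 \<V> \<and> R \<inter> \<Union>\<G>0 \<subseteq> \<Union>\<V>"
    by (rule disjoint_refinement_of_finite_cover[OF \<G>0(1)]) (rule small)
  then obtain \<V> where \<V>: "disjoint_open_refinement X \<G>0 \<V>" "R \<inter> \<Union>\<G>0 \<subseteq> \<Union>\<V>"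
    by metis
  have "refining \<G>0 \<U>"
    unfolding refining_def
  proof
    fix G assume "G \<in> \<G>0"
    then have "G \<in> \<G>" using \<G>0(2) by blast
    then show "\<exists>U\<in>\<U>. G \<subseteq> U" unfolding \<G>_def by blast
  qed
  then have "disjoint_open_refinement X \<U> \<V>"
    using \<V>(1) unfolding disjoint_open_refinement_def refining_def by (meson order_trans)
  moreover have "R \<subseteq> \<Union>\<V>" using \<V>(2) \<G>0(3) by (simp add: inf.absorb1)
  ultimately show "\<exists>\<V>. disjoint_open_refinement X \<U> \<V> \<and> R \<subseteq> \<Union>\<V>" by blast
qed

subsection \<open>Weak infinite-dimensionality and winning strategies\<close>

lemma countable_dim_in_sequence:
  assumes "countable_dim_in X C"
  obtains Z :: "nat \<Rightarrow> 'a set" where "\<And>n. zero_dim_in X (Z n)" "C \<subseteq> (\<Union>n. Z n)"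
proof -
  obtain \<Z> where \<Z>: "countable \<Z>" "\<And>Z. Z \<in> \<Z> \<Longrightarrow> zero_dim_in X Z" "C \<subseteq> \<Union>\<Z>"
    using assms unfolding countable_dim_in_def by metis
  \<comment> \<open>Adding \<open>{}\<close> allows an enumeration by all natural numbers even if
    \<open>\<Z>\<close> is empty.\<close>
  define Z where "Z = from_nat_into (insert {} \<Z>)"
  have range: "range Z = insert {} \<Z>"
    unfolding Z_def using \<Z>(1) by (intro range_from_nat_into) auto
  have "zero_dim_in X (Z n)" for n
    using range \<Z>(2) zero_dim_in_empty by (metis insertE rangeI)
  moreover have "C \<subseteq> (\<Union>n. Z n)" using range \<Z>(3) by simp
  ultimately show thesis using that by blast
qed

lemma zero_dim_in_subtopology:
  assumes Z: "zero_dim_in X Z" "Z \<subseteq> M"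
  shows "zero_dim_in (subtopology X M) Z"
  unfolding zero_dim_in_def
proof (intro conjI allI impI; (elim conjE)?)
  show "Z \<subseteq> topspace (subtopology X M)" using Z unfolding zero_dim_in_def by simp
next
  fix \<U> assume \<U>: "\<forall>U\<in>\<U>. openin (subtopology X M) U" "Z \<subseteq> \<Union>\<U>"
  then have "\<forall>U\<in>\<U>. \<exists>T. openin X T \<and> U = T \<inter> M" unfolding openin_subtopology by blast
  then obtain T where T: "\<And>U. U \<in> \<U> \<Longrightarrow> openin X (T U) \<and> U = T U \<inter> M" by metis
  have "\<forall>U\<in>T ` \<U>. openin X U" "Z \<subseteq> \<Union>(T ` \<U>)" using T \<U>(2) by blast+
  then obtain \<V> where \<V>: "disjoint_open_refinement X (T ` \<U>) \<V>" "Z \<subseteq> \<Union>\<V>"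
    using Z(1) unfolding zero_dim_in_def by metis
  have "disjoint ((\<lambda>V. V \<inter> M) ` \<V>)"
  proof (rule disjointI)
    fix A B assume AB: "A \<in> (\<lambda>V. V \<inter> M) ` \<V>" "B \<in> (\<lambda>V. V \<inter> M) ` \<V>" "A \<noteq> B"
    then obtain V W where VW: "V \<in> \<V>" "W \<in> \<V>" "A = V \<inter> M" "B = W \<inter> M" by blast
    then have "V \<inter> W = {}"
      using \<V>(1) AB(3) unfolding disjoint_open_refinement_def by (metis disjointD)
    then show "A \<inter> B = {}" using VW by blast
  qed
  moreover have "refining ((\<lambda>V. V \<inter> M) ` \<V>) \<U>"
    unfolding refining_def
  proof safe
    fix V assume "V \<in> \<V>"
    then obtain U where "U \<in> \<U>" "V \<subseteq> T U"
      using \<V>(1) unfolding disjoint_open_refinement_def refining_def by blast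
    then have "V \<inter> M \<subseteq> U" using T[of U] by blast
    then show "\<exists>U\<in>\<U>. V \<inter> M \<subseteq> U" using \<open>U \<in> \<U>\<close> by blast
  qed
  moreover have "\<forall>V\<in>(\<lambda>V. V \<inter> M) ` \<V>. openin (subtopology X M) V"
    using \<V>(1) unfolding disjoint_open_refinement_def openin_subtopology by blast
  moreover have "Z \<subseteq> \<Union>((\<lambda>V. V \<inter> M) ` \<V>)" using \<V>(2) Z(2) by blast
  ultimately show "\<exists>\<V>. disjoint_open_refinement (subtopology X M) \<U> \<V> \<and> Z \<subseteq> \<Union>\<V>"
    unfolding disjoint_open_refinement_def by blast
qed

text \<open>Zero-dimensionality passes to the subspace for subsets of \<open>M\<close>, so the
  covering sets are first intersected with \<open>M\<close>; heredity, and with it the development,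
  is needed for this.\<close>

lemma countable_dim_in_subtopology:
  assumes dev: "development X E" and X: "countable_dim_in X M"
  shows "countable_dim_in (subtopology X M) M"
proof -
  obtain \<Z> where \<Z>: "countable \<Z>" "\<And>Z. Z \<in> \<Z> \<Longrightarrow> zero_dim_in X Z" "M \<subseteq> \<Union>\<Z>"
    using X unfolding countable_dim_in_def by metis
  have "zero_dim_in (subtopology X M) (Z \<inter> M)" if "Z \<in> \<Z>" for Z
    using zero_dim_in_subset[OF dev \<Z>(2)[OF that], of "Z \<inter> M"] by (intro zero_dim_in_subtopology) auto
  then show ?thesis
    unfolding countable_dim_in_def
    by (intro exI[of _ "(\<lambda>Z. Z \<inter> M) ` \<Z>"]) (use \<Z> in auto)
qed

text \<open>A strategy is a function, so the answers to all covers have to be chosen at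
  once.\<close>

lemma zero_dim_in_selection:
  assumes "zero_dim_in X Z"
  shows "\<exists>r. \<forall>\<U>. open_cover X \<U> \<longrightarrow> disjoint_open_refinement X \<U> (r \<U>) \<and> Z \<subseteq> \<Union>(r \<U>)"
proof -
  have "\<exists>\<V>. disjoint_open_refinement X \<U> \<V> \<and> Z \<subseteq> \<Union>\<V>" if "open_cover X \<U>" for \<U>
    using assms that unfolding zero_dim_in_def open_cover_def by metis
  then show ?thesis by metis
qed

lemma countable_dim_imp_weakly_infinite_dimensional:
  assumes "countable_dim_in X (topspace X)"
  shows "weakly_infinite_dimensional X"
  unfolding weakly_infinite_dimensional_def
proof (intro allI impI)
  fix \<U> :: "nat \<Rightarrow> 'a set set"
  assume \<U>: "\<forall>k. open_cover X (\<U> k) \<and> card (\<U> k) = 2"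
  obtain Z where Z: "\<And>n::nat. zero_dim_in X (Z n)" "topspace X \<subseteq> (\<Union>n. Z n)"
    using countable_dim_in_sequence[OF assms] by metis
  have "\<exists>\<V>. disjoint_open_refinement X (\<U> k) \<V> \<and> Z k \<subseteq> \<Union>\<V>" for k
    using zero_dim_in_selection[OF Z(1)[of k]] \<U> by metis
  then obtain \<V> where \<V>: "\<And>k. disjoint_open_refinement X (\<U> k) (\<V> k)" "\<And>k. Z k \<subseteq> \<Union>(\<V> k)"
    by metis
  have op: "\<And>k V. V \<in> \<V> k \<Longrightarrow> openin X V" using \<V>(1) unfolding disjoint_open_refinement_def by blast
  have "open_cover X (\<Union>k. \<V> k)"
    unfolding open_cover_def
  proof (intro conjI ballI equalityI subsetI)
    fix V assume "V \<in> (\<Union>k. \<V> k)" then show "openin X V" using op by blast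
  next
    fix x assume "x \<in> \<Union>(\<Union>k. \<V> k)" then show "x \<in> topspace X" using op openin_subset by blast
  next
    fix x assume "x \<in> topspace X"
    then obtain k where "x \<in> Z k" using Z(2) by blast
    then show "x \<in> \<Union>(\<Union>k. \<V> k)" using \<V>(2)[of k] by blast
  qed
  then show "\<exists>\<V>. (\<forall>k. disjoint (\<V> k) \<and> refining (\<V> k) (\<U> k)) \<and> open_cover X (\<Union>k. \<V> k)"
    using \<V>(1) unfolding disjoint_open_refinement_def by (intro exI[of _ \<V>]) auto
qed

section \<open>Consequences of a winning strategy of TWO\<close>

lemma TWO_winning_strategyD:
  assumes \<sigma>: "TWO_winning_strategy \<beta> X \<sigma>" and A: "\<And>\<gamma>. \<gamma> \<in> Field \<beta> \<Longrightarrow> open_cover X (A \<gamma>)"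
  shows "open_cover X (\<Union>\<gamma>\<in>Field \<beta>. \<sigma> \<gamma> (restrict A (under \<beta> \<gamma>)))"
    and "\<gamma> \<in> Field \<beta> \<Longrightarrow> disjoint_open_refinement X (A \<gamma>) (\<sigma> \<gamma> (restrict A (under \<beta> \<gamma>)))"
proof -
  have "(\<forall>\<gamma>\<in>Field \<beta>. open_cover X (A \<gamma>)) \<longrightarrow>
      (\<forall>\<gamma>\<in>Field \<beta>. disjoint (\<sigma> \<gamma> (restrict A (under \<beta> \<gamma>))) \<and> refining (\<sigma> \<gamma> (restrict A (under \<beta> \<gamma>))) (A \<gamma>)) \<and>
      open_cover X (\<Union>\<gamma>\<in>Field \<beta>. \<sigma> \<gamma> (restrict A (under \<beta> \<gamma>)))"
    using \<sigma> unfolding TWO_winning_strategy_def Let_def by (rule spec)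
  then have *: "\<forall>\<gamma>\<in>Field \<beta>. disjoint (\<sigma> \<gamma> (restrict A (under \<beta> \<gamma>))) \<and> refining (\<sigma> \<gamma> (restrict A (under \<beta> \<gamma>))) (A \<gamma>)"
    and cov: "open_cover X (\<Union>\<gamma>\<in>Field \<beta>. \<sigma> \<gamma> (restrict A (under \<beta> \<gamma>)))"
    using A by auto
  show "open_cover X (\<Union>\<gamma>\<in>Field \<beta>. \<sigma> \<gamma> (restrict A (under \<beta> \<gamma>)))" by (rule cov)
  \<comment> \<open>Legality of a move asks only for disjointness and refinement; openness is read
    off from the final cover, to which all members belong.\<close>
  show "disjoint_open_refinement X (A \<gamma>) (\<sigma> \<gamma> (restrict A (under \<beta> \<gamma>)))" if "\<gamma> \<in> Field \<beta>"
    using * cov that unfolding disjoint_open_refinement_def open_cover_def by auto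
qed

text \<open>
  ONE only plays the covers \<open>E n\<close>.  For a history \<open>s\<close> of indices, \<open>C \<gamma> s\<close> is the set of points that
  TWO covers in inning \<open>\<gamma>\<close> whatever the index played there; it is zero-dimensional.  A point outside
  all these sets would allow ONE, inning by inning, to keep it uncovered for ever.
\<close>
lemma winning_strategy_imp_countable_dim:
  fixes \<beta> :: "'o::countable rel"
  assumes dev: "development X E" and wo: "Well_order \<beta>" and fin: "\<And>\<gamma>. \<gamma> \<in> Field \<beta> \<Longrightarrow> finite (under \<beta> \<gamma>)"
    and win: "TWO_has_winning_strategy \<beta> X"
  shows "countable_dim_in X (topspace X)"
proof -
  obtain \<sigma> where \<sigma>: "TWO_winning_strategy \<beta> X \<sigma>"
    using win unfolding TWO_has_winning_strategy_def by blast
  have E: "open_cover X (E n)" for n using dev unfolding development_def by blast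
  define B where "B = (\<lambda>t \<gamma>. \<sigma> \<gamma> (restrict (\<lambda>\<delta>. E (t \<delta>)) (under \<beta> \<gamma>)))"
  have cover: "open_cover X (\<Union>\<gamma>\<in>Field \<beta>. B t \<gamma>)" for t
    unfolding B_def using TWO_winning_strategyD(1)[OF \<sigma>, of "\<lambda>\<delta>. E (t \<delta>)"] E by simp
  have B: "disjoint_open_refinement X (E (t \<gamma>)) (B t \<gamma>)" if "\<gamma> \<in> Field \<beta>" for t \<gamma>
    unfolding B_def using TWO_winning_strategyD(2)[OF \<sigma>, of "\<lambda>\<delta>. E (t \<delta>)"] E that by simp
  have B_cong: "B t \<gamma> = B t' \<gamma>" if "\<And>\<delta>. \<delta> \<in> under \<beta> \<gamma> \<Longrightarrow> t \<delta> = t' \<delta>" for t t' \<gamma>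
    unfolding B_def using that by (auto intro!: arg_cong[of _ _ "\<sigma> \<gamma>"] restrict_ext)
  define C where "C = (\<lambda>\<gamma> s. \<Inter>n. \<Union>(B (s(\<gamma> := n)) \<gamma>))"
  \<comment> \<open>Histories are extensional functions from the finite set
    \<open>under \<beta> \<gamma>\<close> to the natural numbers, so there are only countably
    many.\<close>
  define \<Z> where "\<Z> = (\<Union>\<gamma>\<in>Field \<beta>. C \<gamma> ` (under \<beta> \<gamma> \<rightarrow>\<^sub>E UNIV))"
  have "countable \<Z>"
    unfolding \<Z>_def using fin by (intro countable_UN countable_image countable_PiE) auto
  moreover have "zero_dim_in X (C \<gamma> s)" if "\<gamma> \<in> Field \<beta>" for \<gamma> s
  proof (rule zero_dim_in_of_fine_families[OF dev])
    show "disjoint_open_refinement X (E n) (B (s(\<gamma> := n)) \<gamma>)" for n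
      using B[OF that, of "s(\<gamma> := n)"] by simp
    show "C \<gamma> s \<subseteq> \<Union>(B (s(\<gamma> := n)) \<gamma>)" for n unfolding C_def by blast
  qed
  then have "\<forall>Z\<in>\<Z>. zero_dim_in X Z" unfolding \<Z>_def by blast
  moreover have "topspace X \<subseteq> \<Union>\<Z>"
  proof
    fix x assume x: "x \<in> topspace X"
    show "x \<in> \<Union>\<Z>"
    proof (rule ccontr)
      assume non: "x \<notin> \<Union>\<Z>"
      have notC: "x \<notin> C \<gamma> s" if "\<gamma> \<in> Field \<beta>" for \<gamma> s
      proof -
        have "C \<gamma> s = C \<gamma> (restrict s (under \<beta> \<gamma>))"
          unfolding C_def by (intro INF_cong refl arg_cong[of _ _ Union] B_cong) auto
        moreover have "restrict s (under \<beta> \<gamma>) \<in> under \<beta> \<gamma> \<rightarrow>\<^sub>E UNIV" by simp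
        then have "C \<gamma> (restrict s (under \<beta> \<gamma>)) \<in> \<Z>" unfolding \<Z>_def using that by blast
        ultimately show ?thesis using non by (metis UnionI)
      qed
      have "wf (\<beta> - Id)" using wo unfolding well_order_on_def by blast
      \<comment> \<open>The update \<open>t(\<gamma> := t \<gamma>)\<close> is \<open>t\<close>
        itself; the form fits choice along a well-founded relation, where the index at \<gamma> is
        picked after all earlier ones.\<close>
      then have "\<exists>t. \<forall>\<gamma>. \<gamma> \<in> Field \<beta> \<longrightarrow> x \<notin> \<Union>(B (t(\<gamma> := t \<gamma>)) \<gamma>)"
      proof (rule dependent_wf_choice)
        fix f g :: "'o \<Rightarrow> nat" and \<gamma> r
        assume "\<And>z. (z, \<gamma>) \<in> \<beta> - Id \<Longrightarrow> f z = g z"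
        then have "B (f(\<gamma> := r)) \<gamma> = B (g(\<gamma> := r)) \<gamma>"
          by (intro B_cong) (auto simp: under_def)
        then show "(\<gamma> \<in> Field \<beta> \<longrightarrow> x \<notin> \<Union>(B (f(\<gamma> := r)) \<gamma>)) = (\<gamma> \<in> Field \<beta> \<longrightarrow> x \<notin> \<Union>(B (g(\<gamma> := r)) \<gamma>))"
          by simp
      next
        fix \<gamma> f
        show "\<exists>r. \<gamma> \<in> Field \<beta> \<longrightarrow> x \<notin> \<Union>(B (f(\<gamma> := r)) \<gamma>)"
          using notC[of \<gamma> f] unfolding C_def by blast
      qed
      then obtain t where "\<And>\<gamma>. \<gamma> \<in> Field \<beta> \<Longrightarrow> x \<notin> \<Union>(B t \<gamma>)" by auto
      then have "x \<notin> \<Union>(\<Union>\<gamma>\<in>Field \<beta>. B t \<gamma>)" by blast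
      then show False using cover[of t] x unfolding open_cover_def by blast
    qed
  qed
  ultimately show ?thesis unfolding countable_dim_in_def by blast
qed

subsection \<open>The order \<open>1 + (\<omega> + 1)\<close>\<close>

lemma ord_sum_iff [simp]:
  "(Inl a, Inl a') \<in> ord_sum r s \<longleftrightarrow> (a, a') \<in> r"
  "(Inr b, Inr b') \<in> ord_sum r s \<longleftrightarrow> (b, b') \<in> s"
  "(Inl a, Inr b) \<in> ord_sum r s \<longleftrightarrow> a \<in> Field r \<and> b \<in> Field s"
  "(Inr b, Inl a) \<notin> ord_sum r s"
  unfolding ord_sum_def by auto

lemma Field_ord_sum: "Field (ord_sum r s) = Inl ` Field r \<union> Inr ` Field s"
proof (intro equalityI subsetI)
  fix x assume "x \<in> Field (ord_sum r s)"
  then show "x \<in> Inl ` Field r \<union> Inr ` Field s"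
    unfolding ord_sum_def Field_def by blast
next
  fix x assume "x \<in> Inl ` Field r \<union> Inr ` Field s"
  then consider a a' where "x = Inl a" "(a, a') \<in> r \<or> (a', a) \<in> r" | b b' where "x = Inr b" "(b, b') \<in> s \<or> (b', b) \<in> s"
    unfolding Field_def by blast
  then show "x \<in> Field (ord_sum r s)"
    by cases (metis FieldI1 FieldI2 ord_sum_iff(1), metis FieldI1 FieldI2 ord_sum_iff(2))
qed

\<comment> \<open>The left-hand side is the form into which the simplifier turns \<open>natLeq_on 1\<close>.\<close>
lemma Field_natLeq_on_one [simp]: "Field {(x, y). x = (0::nat) \<and> y = 0 \<and> x \<le> y} = {0}"
  by (auto simp: Field_def)

lemma Well_order_ord_sum:
  assumes r: "Well_order r" and s: "Well_order s"
  shows "Well_order (ord_sum r s)"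
proof -
  have R: "refl_on (Field r) r" "trans r" "antisym r" "total_on (Field r) r" "wf (r - Id)"
    and S: "refl_on (Field s) s" "trans s" "antisym s" "total_on (Field s) s" "wf (s - Id)"
    using r s unfolding order_on_defs by auto
  have "refl_on (Field (ord_sum r s)) (ord_sum r s)"
    unfolding Field_ord_sum using R(1) S(1) unfolding refl_on_def by auto
  moreover have "trans (ord_sum r s)"
  proof (rule transI)
    fix x y z assume *: "(x, y) \<in> ord_sum r s" "(y, z) \<in> ord_sum r s"
    show "(x, z) \<in> ord_sum r s"
      by (cases x; cases y; cases z)
        (use * in \<open>simp; blast intro: FieldI1 FieldI2 dest: transD[OF R(2)] transD[OF S(2)]\<close>)+
  qed
  moreover have "antisym (ord_sum r s)"
  proof (rule antisymI)
    fix x y assume *: "(x, y) \<in> ord_sum r s" "(y, x) \<in> ord_sum r s"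
    show "x = y"
      by (cases x; cases y) (use * in \<open>simp add: antisymD[OF R(3)] antisymD[OF S(3)]\<close>)+
  qed
  moreover have "total_on (Field (ord_sum r s)) (ord_sum r s)"
    unfolding Field_ord_sum
  proof (rule total_onI)
    fix x y assume *: "x \<in> Inl ` Field r \<union> Inr ` Field s" "y \<in> Inl ` Field r \<union> Inr ` Field s" "x \<noteq> y"
    have "(a, a') \<in> r \<or> (a', a) \<in> r" if "a \<in> Field r" "a' \<in> Field r" "a \<noteq> a'" for a a'
      using R(4) that unfolding total_on_def by blast
    moreover have "(b, b') \<in> s \<or> (b', b) \<in> s" if "b \<in> Field s" "b' \<in> Field s" "b \<noteq> b'" for b b'
      using S(4) that unfolding total_on_def by blast
    ultimately show "(x, y) \<in> ord_sum r s \<or> (y, x) \<in> ord_sum r s"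
      using * by (cases x; cases y) auto
  qed
  moreover have "wf (ord_sum r s - Id)"
    unfolding wf_eq_minimal
  proof (intro allI impI)
    fix Q :: "('a + 'b) set" and x assume x: "x \<in> Q"
    show "\<exists>z\<in>Q. \<forall>y. (y, z) \<in> ord_sum r s - Id \<longrightarrow> y \<notin> Q"
    proof (cases "Inl -` Q = {}")
      case False
      then obtain z where z: "z \<in> Inl -` Q" "\<And>y. (y, z) \<in> r - Id \<Longrightarrow> y \<notin> Inl -` Q"
        using R(5) unfolding wf_eq_minimal by blast
      have "y \<notin> Q" if "(y, Inl z) \<in> ord_sum r s - Id" for y
        using that z(2) by (cases y) auto
      then show ?thesis using z(1) by blast
    next
      case True
      then have Q: "\<And>a. Inl a \<notin> Q" by auto
      then have "Inr -` Q \<noteq> {}" using x by (cases x) auto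
      then obtain z where z: "z \<in> Inr -` Q" "\<And>y. (y, z) \<in> s - Id \<Longrightarrow> y \<notin> Inr -` Q"
        using S(5) unfolding wf_eq_minimal by blast
      have "y \<notin> Q" if "(y, Inr z) \<in> ord_sum r s - Id" for y
        using that z(2) Q by (cases y) auto
      then show ?thesis using z(1) by blast
    qed
  qed
  ultimately show ?thesis unfolding order_on_defs by (auto intro: FieldI1 FieldI2)
qed

text \<open>The leading 1 stems from the definition of game dimension. Since 1 + \<omega> =
  \<omega>, the order type is \<omega> + 1, with last inning \<open>Inr (Inr 0)\<close>.\<close>

abbreviation one_omega_one :: "(nat + (nat + nat)) rel" where
  "one_omega_one \<equiv> ord_sum (natLeq_on 1) (ord_sum natLeq (natLeq_on 1))"

lemma Field_one_omega_one: "Field one_omega_one = insert (Inl 0) (insert (Inr (Inr 0)) (range (\<lambda>n. Inr (Inl n))))"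
  unfolding Field_ord_sum Field_natLeq_on Field_natLeq by auto

text \<open>A smaller ordinal is isomorphic to a proper initial segment. Such a segment omits the
  last element, and every other element has finitely many predecessors.\<close>

lemma finite_under_of_less_one_omega_one:
  assumes less: "(\<beta>, one_omega_one) \<in> ordLess" and \<gamma>: "\<gamma> \<in> Field \<beta>"
  shows "finite (under \<beta> \<gamma>)"
proof -
  have wo: "Well_order \<beta>" "Well_order one_omega_one"
    using less unfolding ordLess_def by auto
  obtain a where a: "a \<in> Field one_omega_one" "(\<beta>, Restr one_omega_one (underS one_omega_one a)) \<in> ordIso"
    using less ordLess_iff_ordIso_Restr[OF wo(2,1)] by blast
  define \<rho> where "\<rho> = Restr one_omega_one (underS one_omega_one a)"
  obtain f where f: "embed \<beta> \<rho> f" "bij_betw f (Field \<beta>) (Field \<rho>)"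
    using a(2) unfolding ordIso_def iso_def \<rho>_def by blast
  have bij: "bij_betw f (under \<beta> \<gamma>) (under \<rho> (f \<gamma>))"
    using f(1) \<gamma> unfolding embed_def by blast
  have "f \<gamma> \<in> Field \<rho>" using f(2) \<gamma> unfolding bij_betw_def by blast
  then have fa: "f \<gamma> \<in> underS one_omega_one a" unfolding \<rho>_def Field_def by auto
  then have "f \<gamma> \<in> Field one_omega_one" unfolding underS_def by (auto intro: FieldI1)
  moreover have "f \<gamma> \<noteq> Inr (Inr 0)"
  proof
    assume "f \<gamma> = Inr (Inr 0)"
    then have "(Inr (Inr 0), a) \<in> one_omega_one" "a \<noteq> Inr (Inr 0)" using fa unfolding underS_def by auto
    then show False using a(1) unfolding Field_one_omega_one by auto
  qed
  ultimately consider "f \<gamma> = Inl 0" | n where "f \<gamma> = Inr (Inl n)" unfolding Field_one_omega_one by blast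
  then have "finite (under one_omega_one (f \<gamma>))"
  proof cases
    case 1
    have "x \<in> {Inl 0}" if "(x, Inl 0) \<in> one_omega_one" for x
      using that by (cases x) auto
    then have "under one_omega_one (f \<gamma>) \<subseteq> {Inl 0}" unfolding 1 under_def by blast
    then show ?thesis by (rule finite_subset) simp
  next
    case 2
    have "x \<in> insert (Inl 0) ((\<lambda>k. Inr (Inl k)) ` {..n})" if "(x, Inr (Inl n)) \<in> one_omega_one" for x
    proof (cases x)
      case (Inl a)
      then show ?thesis using that by simp
    next
      case (Inr b)
      then show ?thesis using that by (cases b) (auto simp: natLeq_def)
    qed
    then have "under one_omega_one (f \<gamma>) \<subseteq> insert (Inl 0) ((\<lambda>k. Inr (Inl k)) ` {..n})"
      unfolding 2 under_def by blast
    then show ?thesis by (rule finite_subset) simp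
  qed
  moreover have "under \<rho> (f \<gamma>) \<subseteq> under one_omega_one (f \<gamma>)"
    unfolding \<rho>_def under_def by auto
  ultimately have "finite (under \<rho> (f \<gamma>))" by (rule finite_subset[rotated])
  then show ?thesis using bij bij_betw_finite by blast
qed

subsection \<open>The game on Pol's compactum\<close>

text \<open>What is left after \<omega> innings depends on ONE's play, so \<open>rest\<close> speaks
  of every open \<open>G\<close> containing the sets \<open>Z n\<close>.\<close>

lemma TWO_wins_one_omega_one:
  assumes Z: "\<And>n::nat. zero_dim_in X (Z n)"
    and rest: "\<And>G. openin X G \<Longrightarrow> (\<Union>n. Z n) \<subseteq> G \<Longrightarrow> zero_dim_in X (topspace X - G)"
  shows "TWO_has_winning_strategy one_omega_one X"
proof -
  have "\<exists>r. \<forall>\<U>. open_cover X \<U> \<longrightarrow> disjoint_open_refinement X \<U> (r \<U>) \<and> Z n \<subseteq> \<Union>(r \<U>)" for n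
    by (rule zero_dim_in_selection[OF Z])
  then obtain r where r: "\<And>n \<U>. open_cover X \<U> \<Longrightarrow> disjoint_open_refinement X \<U> (r n \<U>) \<and> Z n \<subseteq> \<Union>(r n \<U>)"
    by metis
  \<comment> \<open>The remainder \<open>R\<close> is not known in advance, so \<open>q\<close> is
    defined for all arguments; it is meaningful once \<open>R\<close> is zero-dimensional and
    \<open>\<U>\<close> is an open cover.\<close>
  define q where "q = (\<lambda>R \<U>. SOME \<V>. disjoint_open_refinement X \<U> \<V> \<and> R \<subseteq> \<Union>\<V>)"
  have q: "disjoint_open_refinement X \<U> (q R \<U>) \<and> R \<subseteq> \<Union>(q R \<U>)" if "zero_dim_in X R" "open_cover X \<U>" for R \<U>
  proof -
    have "\<exists>\<V>. disjoint_open_refinement X \<U> \<V> \<and> R \<subseteq> \<Union>\<V>"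
      using zero_dim_in_selection[OF that(1)] that(2) by metis
    then show ?thesis unfolding q_def by (rule someI_ex)
  qed
  \<comment> \<open>The initial inning is passed with the empty family, which is legal. In the last
    inning the set already covered is recomputed from ONE's moves, the only ones a strategy
    sees.\<close>
  define \<sigma> where "\<sigma> = (\<lambda>(\<gamma> :: nat + (nat + nat)) A. case \<gamma> of Inl _ \<Rightarrow> {} | Inr (Inl n) \<Rightarrow> r n (A \<gamma>)
     | Inr (Inr _) \<Rightarrow> q (topspace X - (\<Union>n. \<Union>(r n (A (Inr (Inl n)))))) (A \<gamma>))"
  have "TWO_winning_strategy one_omega_one X \<sigma>"
    unfolding TWO_winning_strategy_def Let_def
  proof (intro allI impI)
    fix A assume "\<forall>\<gamma>\<in>Field one_omega_one. open_cover X (A \<gamma>)"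
    then have A: "open_cover X (A (Inl 0))" "\<And>n. open_cover X (A (Inr (Inl n)))" "open_cover X (A (Inr (Inr 0)))"
      unfolding Field_one_omega_one by auto
    define B where "B = (\<lambda>\<gamma>. \<sigma> \<gamma> (restrict A (under one_omega_one \<gamma>)))"
    define G where "G = (\<Union>n. \<Union>(r n (A (Inr (Inl n)))))"
    have B0: "B (Inl 0) = {}" unfolding B_def \<sigma>_def by simp
    have Bn: "B (Inr (Inl n)) = r n (A (Inr (Inl n)))" for n
      unfolding B_def \<sigma>_def by (simp add: under_def natLeq_def)
    have Bw: "B (Inr (Inr 0)) = q (topspace X - G) (A (Inr (Inr 0)))"
      unfolding B_def \<sigma>_def G_def by (simp add: under_def Field_natLeq Field_ord_sum)
    have dn: "disjoint_open_refinement X (A (Inr (Inl n))) (B (Inr (Inl n)))" "Z n \<subseteq> \<Union>(B (Inr (Inl n)))" for n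
      using r[OF A(2)] unfolding Bn by auto
    have "openin X G"
      using dn(1) unfolding G_def Bn disjoint_open_refinement_def by (intro openin_Union) auto
    moreover have "(\<Union>n. Z n) \<subseteq> G" using dn(2) unfolding G_def Bn by blast
    ultimately have dw: "disjoint_open_refinement X (A (Inr (Inr 0))) (B (Inr (Inr 0)))" "topspace X - G \<subseteq> \<Union>(B (Inr (Inr 0)))"
      using q[OF rest A(3)] unfolding Bw by auto
    have all: "disjoint_open_refinement X (A \<gamma>) (B \<gamma>)" if "\<gamma> \<in> Field one_omega_one" for \<gamma>
      using that dn(1) dw(1) B0 unfolding Field_one_omega_one
      by (auto simp: disjoint_open_refinement_def refining_def)
    have "open_cover X (\<Union>\<gamma>\<in>Field one_omega_one. B \<gamma>)"
      unfolding open_cover_def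
    proof (intro conjI ballI equalityI subsetI)
      fix V assume "V \<in> (\<Union>\<gamma>\<in>Field one_omega_one. B \<gamma>)"
      then show "openin X V" using all unfolding disjoint_open_refinement_def by blast
    next
      fix x assume "x \<in> \<Union>(\<Union>\<gamma>\<in>Field one_omega_one. B \<gamma>)"
      then show "x \<in> topspace X" using all openin_subset unfolding disjoint_open_refinement_def by blast
    next
      fix x assume x: "x \<in> topspace X"
      show "x \<in> \<Union>(\<Union>\<gamma>\<in>Field one_omega_one. B \<gamma>)"
      proof (cases "x \<in> G")
        case True
        then obtain n where "x \<in> \<Union>(B (Inr (Inl n)))" unfolding G_def Bn by blast
        then show ?thesis unfolding Field_one_omega_one by blast
      next
        case False
        then have "x \<in> \<Union>(B (Inr (Inr 0)))" using dw(2) x by blast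
        then show ?thesis unfolding Field_one_omega_one by blast
      qed
    qed
    then show "(\<forall>\<gamma>\<in>Field one_omega_one. disjoint (\<sigma> \<gamma> (restrict A (under one_omega_one \<gamma>))) \<and>
           refining (\<sigma> \<gamma> (restrict A (under one_omega_one \<gamma>))) (A \<gamma>)) \<and>
        open_cover X (\<Union>\<gamma>\<in>Field one_omega_one. \<sigma> \<gamma> (restrict A (under one_omega_one \<gamma>)))"
      using all unfolding B_def disjoint_open_refinement_def by blast
  qed
  then show ?thesis unfolding TWO_has_winning_strategy_def by blast
qed

theorem mainTheorem5:
  fixes K :: "'a topology" and M :: "'a set" and L :: "nat \<Rightarrow> 'a set"
  assumes "Pol_compactum K M L"
  shows "has_game_dim K (ord_sum natLeq (natLeq_on 1))"
proof -
  have K: "compact_space K" "metrizable_space K" and M: "M \<subseteq> topspace K"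
    and td: "totally_disconnected_space (subtopology K M)"
    and strong: "strongly_infinite_dimensional (subtopology K M)"
    and L: "topspace K - M = (\<Union>k. L k)" "\<And>k. compactin K (L k)"
    and "\<exists>d :: nat \<Rightarrow> int. strict_mono d \<and> (\<forall>k. has_covering_dim (subtopology K (L k)) (d k))"
    using assms unfolding Pol_compactum_def hereditarily_strongly_infinite_dimensional_def by simp_all
  then obtain d :: "nat \<Rightarrow> int" where dimL: "\<And>k. covering_dim_le (subtopology K (L k)) (d k)"
    unfolding has_covering_dim_def by metis
  have sep: "normal_space K" "Hausdorff_space K" "regular_space K"
    using K metrizable_imp_normal_space metrizable_imp_Hausdorff_space metrizable_imp_regular_space by auto
  obtain E where dev: "development K E" using metrizable_imp_development[OF K(2)] by blast
  have "countable_dim_in K (L k)" for k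
  proof -
    have "colour_cover K (nat (d k + 1)) (L k)"
      by (rule covering_dim_le_imp_colour_cover[OF sep(1,3) L(2) dimL])
    then show ?thesis
      using colour_cover_imp_countable_dim[OF K(1) sep(1) dev] compactin_imp_closedin[OF sep(2) L(2)] by blast
  qed
  then have "countable_dim_in K (\<Union>(range L))"
    by (intro countable_dim_in_Union) auto
  then obtain Z where Z: "\<And>n::nat. zero_dim_in K (Z n)" "\<Union>(range L) \<subseteq> (\<Union>n. Z n)"
    using countable_dim_in_sequence by metis
  have rest: "zero_dim_in K (topspace K - G)" if "openin K G" "(\<Union>n. Z n) \<subseteq> G" for G
  proof (rule totally_disconnected_compact_imp_zero_dim[OF sep(1,2)])
    show "compactin K (topspace K - G)" using K(1) that(1) by (meson closedin_compact_space closedin_diff closedin_topspace)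
    have "topspace K - G \<subseteq> M" using L(1) Z(2) that(2) by blast
    then show "totally_disconnected_space (subtopology K (topspace K - G))"
      using td unfolding totally_disconnected_space_def connectedin_subtopology by (meson order_trans)
  qed
  have "TWO_has_winning_strategy one_omega_one K"
    by (rule TWO_wins_one_omega_one[OF Z(1) rest])
  moreover have "\<not> TWO_has_winning_strategy \<beta> K" if less: "(\<beta>, one_omega_one) \<in> ordLess" for \<beta> :: "(nat + (nat + nat)) rel"
  proof
    assume win: "TWO_has_winning_strategy \<beta> K"
    have "Well_order \<beta>" using less unfolding ordLess_def by auto
    then have "countable_dim_in K (topspace K)"
      using winning_strategy_imp_countable_dim[OF dev _ finite_under_of_less_one_omega_one[OF less] win] by blast
    then have "countable_dim_in K M" using M by (rule countable_dim_in_mono)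
    \<comment> \<open>Strong infinite dimensionality concerns \<open>M\<close> as a space of its
      own, so the decomposition has to be moved to the subspace topology.\<close>
    then have "countable_dim_in (subtopology K M) (topspace (subtopology K M))"
      using countable_dim_in_subtopology[OF dev] M by (simp add: inf.absorb2)
    then show False
      using strong countable_dim_imp_weakly_infinite_dimensional unfolding strongly_infinite_dimensional_def by blast
  qed
  moreover have "Well_order (ord_sum natLeq (natLeq_on 1))"
    by (intro Well_order_ord_sum natLeq_Well_order natLeq_on_Well_order)
  moreover from this have "Well_order one_omega_one"
    by (rule Well_order_ord_sum[OF natLeq_on_Well_order])
  ultimately show ?thesis unfolding has_game_dim_def is_game_type_def by blast
qed

end
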